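(* Let $r \ge 3$ and let $p_1,\dots,p_r$ be independent random elements of $\mathbb{Z}_2^*$, each distributed according to normalized Haar measure. Then the probability that $p_1p_2\cdots p_r$ is 2-Korselt equals $$\frac{1}{2^r-1}\left[1 + \sum_{\substack{2 \le s < r\\ s \text{ even}}} \binom{r}{s} \sum_{j=0}^{r-s} (-1)^j \binom{r-s}{j}\frac{1}{2^{j+1}-1}\right].$$
   Context: $\mathbb{Z}_2^*$ is the group of units (odd elements) of the 2-adic integers; Haar measure corresponds to the binary digits above the units digit being independent fair coin flips. The product $p_1\cdots p_r$ is called 2-Korselt if $\nu_2(p_1\cdots p_r - 1) \ge \max_i \nu_2(p_i - 1)$, where $\nu_2$ is the 2-adic valuation. *)

theory Defs
  imports "HOL-Probability.Probability"
begin

text \<open>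
  A 2-adic integer is a coherent sequence of residues: its \<open>n\<close>-th entry is the canonical
  representative in \<open>{0..<2 ^ n}\<close> of the class modulo \<open>2 ^ n\<close>
  (the range condition is implied by coherence).
\<close>

typedef two_adic = "{f :: nat \<Rightarrow> int. \<forall>n. f n = f (Suc n) mod 2 ^ n}"
  morphisms residue Abs_two_adic
  by (rule exI[of _ "\<lambda>_. 0"]) simp

setup_lifting type_definition_two_adic

lemma mod_mod_power_Suc: "(a :: int) mod 2 ^ Suc n mod 2 ^ n = a mod 2 ^ n"
  by (simp add: mod_mod_cancel le_imp_power_dvd)

lemma residue_coherent: "residue x n = residue x (Suc n) mod 2 ^ n"
  using residue[of x] by blast

lemma residue_mod: "residue x n mod 2 ^ n = residue x n"
  by (metis residue_coherent mod_mod_trivial)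

lemma two_adic_eqI: "(\<And>n. residue x n = residue y n) \<Longrightarrow> x = y"
  by (metis residue_inject ext)

instantiation two_adic :: comm_ring_1
begin

lift_definition zero_two_adic :: two_adic is "\<lambda>_. 0" by simp

lift_definition one_two_adic :: two_adic is "\<lambda>n. 1 mod 2 ^ n"
  by (simp add: mod_mod_power_Suc del: power_Suc)

lift_definition plus_two_adic :: "two_adic \<Rightarrow> two_adic \<Rightarrow> two_adic"
  is "\<lambda>f g n. (f n + g n) mod 2 ^ n"
  unfolding mod_mod_power_Suc by (metis mod_add_eq)

lift_definition uminus_two_adic :: "two_adic \<Rightarrow> two_adic"
  is "\<lambda>f n. (- f n) mod 2 ^ n"
  unfolding mod_mod_power_Suc by (metis mod_minus_eq)

lift_definition minus_two_adic :: "two_adic \<Rightarrow> two_adic \<Rightarrow> two_adic"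
  is "\<lambda>f g n. (f n - g n) mod 2 ^ n"
  unfolding mod_mod_power_Suc by (metis mod_diff_eq)

lift_definition times_two_adic :: "two_adic \<Rightarrow> two_adic \<Rightarrow> two_adic"
  is "\<lambda>f g n. (f n * g n) mod 2 ^ n"
  unfolding mod_mod_power_Suc by (metis mod_mult_eq)

instance
proof
  note res = plus_two_adic.rep_eq times_two_adic.rep_eq minus_two_adic.rep_eq
    uminus_two_adic.rep_eq zero_two_adic.rep_eq one_two_adic.rep_eq residue_mod
  fix a b c :: two_adic
  show "a + b + c = a + (b + c)"
    by (rule two_adic_eqI) (simp add: res mod_simps add.assoc)
  show "a + b = b + a"
    by (rule two_adic_eqI) (simp add: res add.commute)
  show "0 + a = a"
    by (rule two_adic_eqI) (simp add: res)
  show "- a + a = 0"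
    by (rule two_adic_eqI) (simp add: res mod_simps)
  show "a - b = a + - b"
    by (rule two_adic_eqI) (simp add: res mod_simps)
  show "a * b * c = a * (b * c)"
    by (rule two_adic_eqI) (simp add: res mod_simps mult.assoc)
  show "a * b = b * a"
    by (rule two_adic_eqI) (simp add: res mult.commute)
  show "1 * a = a"
    by (rule two_adic_eqI) (simp only: res mod_mult_left_eq mult_1)
  show "(a + b) * c = a * c + b * c"
    by (rule two_adic_eqI) (simp add: res mod_simps ring_distribs)
  have "residue 0 1 \<noteq> residue 1 1"
    by (simp add: res)
  then show "(0 :: two_adic) \<noteq> 1"
    by metis
qed

end

instantiation two_adic :: topological_space
begin

text \<open>The 2-adic topology: the cosets of the ideals generated by \<open>2 ^ n\<close> form a base.\<close>

definition open_two_adic :: "two_adic set \<Rightarrow> bool" where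
  "open_two_adic U \<longleftrightarrow> (\<forall>x\<in>U. \<exists>n. \<forall>y. 2 ^ n dvd y - x \<longrightarrow> y \<in> U)"

instance
proof
  show "open (UNIV :: two_adic set)"
    by (simp add: open_two_adic_def)
next
  fix S T :: "two_adic set"
  assume S: "open S" and T: "open T"
  show "open (S \<inter> T)"
    unfolding open_two_adic_def
  proof
    fix x assume x: "x \<in> S \<inter> T"
    obtain m where m: "\<And>y. 2 ^ m dvd y - x \<Longrightarrow> y \<in> S"
      using S x unfolding open_two_adic_def by blast
    obtain n where n: "\<And>y. 2 ^ n dvd y - x \<Longrightarrow> y \<in> T"
      using T x unfolding open_two_adic_def by blast
    have "\<forall>y. 2 ^ (m + n) dvd y - x \<longrightarrow> y \<in> S \<inter> T"
      using m n by (metis IntI dvd_mult_left dvd_mult_right power_add)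
    then show "\<exists>k. \<forall>y. 2 ^ k dvd y - x \<longrightarrow> y \<in> S \<inter> T" ..
  qed
next
  fix K :: "two_adic set set"
  assume "\<forall>S\<in>K. open S"
  then show "open (\<Union>K)"
    unfolding open_two_adic_def by (meson Union_iff)
qed

end

definition two_adic_units :: "two_adic set" where
  "two_adic_units = {x. x dvd 1}"

lemma residue_mod_le: "n \<le> m \<Longrightarrow> residue x m mod 2 ^ n = residue x n"
proof (induction m)
  case 0
  then show ?case by (metis residue_mod le_zero_eq)
next
  case (Suc m)
  show ?case
  proof (cases "n = Suc m")
    case True
    then show ?thesis by (metis residue_mod)
  next
    case False
    then have "n \<le> m" using Suc by simp
    then have "residue x (Suc m) mod 2 ^ n = residue x (Suc m) mod 2 ^ m mod 2 ^ n"
      by (simp add: mod_mod_cancel le_imp_power_dvd)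
    then show ?thesis
      using Suc.IH \<open>n \<le> m\<close> residue_coherent by metis
  qed
qed

lemma residue_times: "residue (x * y) n = residue x n * residue y n mod 2 ^ n"
  by (simp add: times_two_adic.rep_eq)

lemma residue_one: "residue 1 n = 1 mod 2 ^ n"
  by (simp add: one_two_adic.rep_eq)

lemma residue_two_power: "residue (2 ^ k) n = 2 ^ k mod 2 ^ n"
proof (induction k)
  case 0
  show ?case by (simp only: power_0 residue_one)
next
  case (Suc k)
  have "residue (1 + 1) n = 2 mod 2 ^ n"
    unfolding plus_two_adic.rep_eq residue_one mod_add_eq by simp
  then have "residue 2 n = 2 mod 2 ^ n" by simp
  then show ?case
    unfolding power_Suc residue_times Suc.IH by (simp only: mod_mult_eq)
qed

lemma two_power_dvd_iff: "2 ^ n dvd x \<longleftrightarrow> residue x n = 0"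
proof
  assume "2 ^ n dvd x"
  then obtain y where "x = 2 ^ n * y" by (rule dvdE)
  then show "residue x n = 0"
    by (simp add: residue_times residue_two_power)
next
  assume zero: "residue x n = 0"
  define f where "f = (\<lambda>m. residue x (n + m) div 2 ^ n)"
  have x_f: "residue x (n + m) = 2 ^ n * f m" for m
  proof -
    have "residue x (n + m) mod 2 ^ n = 0"
      using residue_mod_le[of n "n + m" x] zero by simp
    then show ?thesis by (auto simp: f_def)
  qed
  have f_mult: "2 ^ n * f m = 2 ^ n * (f (Suc m) mod 2 ^ m)" for m
    unfolding mult_mod_right x_f[symmetric]
    using residue_coherent[of x "n + m"] by (simp add: power_add)
  have coh: "\<forall>m. f m = f (Suc m) mod 2 ^ m"
  proof
    fix m
    show "f m = f (Suc m) mod 2 ^ m"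
      by (rule mult_left_cancel[THEN iffD1, OF _ f_mult]) simp
  qed
  define y where "y = Abs_two_adic f"
  have y: "residue y = f"
    unfolding y_def by (rule Abs_two_adic_inverse) (use coh in blast)
  have "x = 2 ^ n * y"
  proof (rule two_adic_eqI)
    fix m
    have "residue x m = residue x (n + m) mod 2 ^ m"
      by (simp add: residue_mod_le)
    also have "\<dots> = residue (2 ^ n * y) m"
      by (simp only: x_f residue_times residue_two_power y mod_mult_left_eq)
    finally show "residue x m = residue (2 ^ n * y) m" .
  qed
  then show "2 ^ n dvd x" by simp
qed

lemma two_power_dvd_diff_iff: "2 ^ n dvd x - y \<longleftrightarrow> residue x n = residue y n"
proof -
  have "2 ^ n dvd x - y \<longleftrightarrow> residue x n mod 2 ^ n = residue y n mod 2 ^ n"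
    unfolding two_power_dvd_iff minus_two_adic.rep_eq
    by (simp add: mod_eq_dvd_iff dvd_eq_mod_eq_0)
  then show ?thesis by (simp only: residue_mod)
qed

lemma two_adic_units_iff: "x \<in> two_adic_units \<longleftrightarrow> residue x 1 = 1"
proof
  assume "x \<in> two_adic_units"
  then obtain y where "1 = x * y" by (auto simp: two_adic_units_def)
  then have "residue (x * y) 1 = 1 mod 2 ^ 1" by (metis residue_one)
  then have "odd (residue x 1)"
    by (auto simp: residue_times mod_2_eq_odd split: if_splits)
  then show "residue x 1 = 1"
    using residue_mod[of x 1] by (simp add: mod_2_eq_odd)
next
  assume one: "residue x 1 = 1"
  have cop: "coprime (residue x n) (2 ^ n)" for n
  proof (cases n)
    case (Suc m)
    then have "residue x n mod 2 = 1"
      using residue_mod_le[of 1 n x] one by simp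
    then show ?thesis by (simp add: odd_iff_mod_2_eq_one)
  qed simp
  have ex: "\<exists>b. b mod 2 ^ n = b \<and> residue x n * b mod 2 ^ n = 1 mod 2 ^ n" for n
  proof -
    obtain u v where "u * residue x n + v * 2 ^ n = 1"
      using cop[of n] bezout_int[of "residue x n" "2 ^ n"] by (metis coprime_imp_gcd_eq_1)
    then have "residue x n * u mod 2 ^ n = 1 mod 2 ^ n"
      by (metis mod_mult_self1 mult.commute)
    then show ?thesis
      by (intro exI[of _ "u mod 2 ^ n"]) (simp add: mod_mult_right_eq)
  qed
  define f where "f = (\<lambda>n. SOME b. b mod 2 ^ n = b \<and> residue x n * b mod 2 ^ n = 1 mod 2 ^ n)"
  have f: "f n mod 2 ^ n = f n" "residue x n * f n mod 2 ^ n = 1 mod 2 ^ n" for n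
    using someI_ex[OF ex[of n]] unfolding f_def by blast+
  have "f n = f (Suc n) mod 2 ^ n" for n
  proof -
    have "residue x n * f (Suc n) mod 2 ^ n = residue x (Suc n) * f (Suc n) mod 2 ^ Suc n mod 2 ^ n"
      by (metis mod_mod_power_Suc residue_coherent mod_mult_left_eq)
    also have "\<dots> = residue x n * f n mod 2 ^ n"
      unfolding f(2) mod_mod_power_Suc ..
    finally have "2 ^ n dvd residue x n * (f (Suc n) - f n)"
      by (simp add: mod_eq_dvd_iff right_diff_distrib)
    then have "2 ^ n dvd f (Suc n) - f n"
      using cop[of n] by (metis coprime_commute coprime_dvd_mult_right_iff)
    then show ?thesis
      using f(1)[of n] by (simp add: mod_eq_dvd_iff[symmetric])
  qed
  then have y: "residue (Abs_two_adic f) = f"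
    by (intro Abs_two_adic_inverse) blast
  have "x * Abs_two_adic f = 1"
    by (rule two_adic_eqI) (simp only: residue_times y f(2) residue_one)
  then show "x \<in> two_adic_units"
    unfolding two_adic_units_def by (metis dvdI mem_Collect_eq)
qed

text \<open>The valuation of \<open>0\<close> is \<open>\<infinity>\<close>.\<close>

definition two_adic_valuation :: "two_adic \<Rightarrow> enat" where
  "two_adic_valuation x = (SUP n \<in> {n. 2 ^ n dvd x}. enat n)"

text \<open>
  A normalized Haar measure on a group \<open>G\<close> of units (with the subspace topology). Regularity is not
  required explicitly, since on a compact metrizable group such as \<open>two_adic_units\<close> it holds for
  every Borel probability measure.
\<close>

definition normalized_haar ::
    "'a :: {topological_space, comm_ring_1} set \<Rightarrow> 'a measure \<Rightarrow> bool" where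
  "normalized_haar G \<mu> \<longleftrightarrow>
     prob_space \<mu> \<and> sets \<mu> = sets (restrict_space borel G) \<and>
     (\<forall>g\<in>G. \<forall>A\<in>sets \<mu>. emeasure \<mu> ((\<lambda>x. g * x) ` A) = emeasure \<mu> A)"

text \<open>
  Existence of a normalized Haar measure on \<open>two_adic_units\<close>, as the distribution of the unit whose
  binary digits above the units digit are independent fair coin flips.
\<close>

definition residue_ball :: "nat \<Rightarrow> int \<Rightarrow> two_adic set" where
  "residue_ball n a = {x \<in> two_adic_units. residue x n = a}"

lemma open_residue: "open {x. residue x n = a}"
  unfolding open_two_adic_def two_power_dvd_diff_iff by auto

lemma two_adic_units_eq: "two_adic_units = {x. residue x 1 = 1}"
  using two_adic_units_iff by blast

lemma sets_borel_two_adic_units: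
  "sets (restrict_space borel two_adic_units) =
     sigma_sets two_adic_units (range (case_prod residue_ball))"
proof -
  let ?U = two_adic_units and ?\<S> = "range (case_prod residue_ball)"
  have "?U \<in> sigma_sets UNIV {S. open S}"
    unfolding two_adic_units_eq by (rule sigma_sets.Basic) (simp add: open_residue)
  then have eq: "sets (restrict_space borel ?U) = sigma_sets ?U ((\<inter>) ?U ` {S. open S})"
    by (simp add: sets_restrict_space borel_def sigma_sets_Int)
  have "U \<in> sigma_sets ?U ?\<S>" if "U \<in> (\<inter>) ?U ` {S. open S}" for U
  proof -
    obtain S where S: "open S" "U = ?U \<inter> S" using \<open>U \<in> _\<close> by blast
    let ?I = "{i. case_prod residue_ball i \<subseteq> S}"
    have "U = (\<Union>i\<in>?I. case_prod residue_ball i)"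
    proof
      show "U \<subseteq> (\<Union>i\<in>?I. case_prod residue_ball i)"
      proof
        fix x assume x: "x \<in> U"
        then obtain n where "\<And>y. residue y n = residue x n \<Longrightarrow> y \<in> S"
          using S unfolding open_two_adic_def two_power_dvd_diff_iff by blast
        then have "(n, residue x n) \<in> ?I" by (auto simp: residue_ball_def)
        moreover have "x \<in> residue_ball n (residue x n)"
          using x S by (simp add: residue_ball_def)
        ultimately show "x \<in> (\<Union>i\<in>?I. case_prod residue_ball i)" by blast
      qed
    qed (auto simp: S residue_ball_def)
    also have "\<dots> \<in> sigma_sets ?U ?\<S>"
      by (rule sigma_sets_UNION) (auto intro!: sigma_sets.Basic)
    finally show ?thesis .
  qed
  then have "sigma_sets ?U ((\<inter>) ?U ` {S. open S}) \<subseteq> sigma_sets ?U ?\<S>"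
    by (intro sigma_sets_mono) blast
  moreover have "?\<S> \<subseteq> (\<inter>) ?U ` {S. open S}"
    by (auto simp: residue_ball_def image_iff intro!: exI[of _ "{x. residue x _ = _}"] open_residue)
  then have "sigma_sets ?U ?\<S> \<subseteq> sigma_sets ?U ((\<inter>) ?U ` {S. open S})"
    by (rule sigma_sets_mono')
  ultimately show ?thesis using eq by blast
qed

lemma measurable_two_adic_units:
  assumes "f \<in> space M \<rightarrow> two_adic_units"
    and "\<And>n a. f -` residue_ball n a \<inter> space M \<in> sets M"
  shows "f \<in> measurable M (restrict_space borel two_adic_units)"
  by (rule measurable_sigma_sets[OF sets_borel_two_adic_units])
     (use assms in \<open>auto simp: residue_ball_def\<close>)

lemma residue_ball_empty: "residue_ball 0 1 = {}"
  using residue_mod[of _ 0] by (auto simp: residue_ball_def)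

lemma residue_ball_0: "residue_ball 0 0 = two_adic_units"
  using residue_mod[of _ 0] by (auto simp: residue_ball_def)

lemma residue_ball_Int_le:
  assumes "m \<le> n"
  shows "residue_ball m a \<inter> residue_ball n b \<in> range (case_prod residue_ball)"
proof (cases "b mod 2 ^ m = a")
  case True
  then have "residue_ball m a \<inter> residue_ball n b = residue_ball n b"
    using residue_mod_le[OF assms] by (auto simp: residue_ball_def)
  then show ?thesis by auto
next
  case False
  then have "residue_ball m a \<inter> residue_ball n b = residue_ball 0 1"
    using residue_mod_le[OF assms] unfolding residue_ball_empty by (auto simp: residue_ball_def)
  then show ?thesis by auto
qed

lemma Int_stable_residue_ball: "Int_stable (range (case_prod residue_ball))"
proof (rule Int_stableI)
  fix A B assume "A \<in> range (case_prod residue_ball)" "B \<in> range (case_prod residue_ball)"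
  then obtain m a n b where "A = residue_ball m a" "B = residue_ball n b" by auto
  then show "A \<inter> B \<in> range (case_prod residue_ball)"
    using residue_ball_Int_le[of m n a b] residue_ball_Int_le[of n m b a]
    by (metis Int_commute nat_le_linear)
qed

lemma two_adic_units_measure_eqI:
  assumes "sets \<mu> = sets (restrict_space borel two_adic_units)"
    and "sets \<nu> = sets (restrict_space borel two_adic_units)"
    and "prob_space \<mu>"
    and "\<And>n a. emeasure \<mu> (residue_ball n a) = emeasure \<nu> (residue_ball n a)"
  shows "\<mu> = \<nu>"
proof (rule measure_eqI_generator_eq[OF Int_stable_residue_ball,
      where \<Omega> = two_adic_units and A = "\<lambda>_. residue_ball 0 0"])
  interpret prob_space \<mu> by fact
  show "emeasure \<mu> (residue_ball 0 0) \<noteq> \<infinity>" by simp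
  show "range (\<lambda>_. residue_ball 0 0) \<subseteq> range (case_prod residue_ball)" by auto
  show "(\<Union>i. residue_ball 0 0) = two_adic_units" by (simp add: residue_ball_0)
  show "range (case_prod residue_ball) \<subseteq> Pow two_adic_units" by (auto simp: residue_ball_def)
qed (use assms sets_borel_two_adic_units in auto)

text \<open>The units digit is always 1, so \<open>\<omega> 0\<close> is ignored.\<close>

definition digit_sum :: "(nat \<Rightarrow> bool) \<Rightarrow> nat \<Rightarrow> int" where
  "digit_sum \<omega> n = (\<Sum>k<n. of_bool (k = 0 \<or> \<omega> k) * 2 ^ k)"

definition unit_of_digits :: "(nat \<Rightarrow> bool) \<Rightarrow> two_adic" where
  "unit_of_digits \<omega> = Abs_two_adic (digit_sum \<omega>)"

lemma digit_sum_bounds: "0 \<le> digit_sum \<omega> n" "digit_sum \<omega> n < 2 ^ n"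
proof -
  show "0 \<le> digit_sum \<omega> n"
    unfolding digit_sum_def by (intro sum_nonneg) simp
  show "digit_sum \<omega> n < 2 ^ n"
  proof (induction n)
    case (Suc n)
    have "digit_sum \<omega> (Suc n) = digit_sum \<omega> n + of_bool (n = 0 \<or> \<omega> n) * 2 ^ n"
      by (simp add: digit_sum_def)
    moreover have "of_bool (n = 0 \<or> \<omega> n) * 2 ^ n \<le> (2 :: int) ^ n" by simp
    ultimately have "digit_sum \<omega> (Suc n) < 2 * 2 ^ n" using Suc.IH by linarith
    then show ?case by (simp only: power_Suc)
  qed (simp add: digit_sum_def)
qed

lemma digit_sum_mod: "digit_sum \<omega> n = digit_sum \<omega> (Suc n) mod 2 ^ n"
proof -
  have "digit_sum \<omega> (Suc n) = digit_sum \<omega> n + of_bool (n = 0 \<or> \<omega> n) * 2 ^ n"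
    by (simp add: digit_sum_def)
  then show ?thesis using digit_sum_bounds[of \<omega> n] by simp
qed

lemma residue_unit_of_digits: "residue (unit_of_digits \<omega>) = digit_sum \<omega>"
  unfolding unit_of_digits_def by (rule Abs_two_adic_inverse) (use digit_sum_mod in blast)

lemma unit_of_digits: "unit_of_digits \<omega> \<in> two_adic_units"
  unfolding two_adic_units_iff residue_unit_of_digits by (simp add: digit_sum_def)

lemma digit_sum_eq_iff: "digit_sum \<omega> n = digit_sum \<omega>' n \<longleftrightarrow> (\<forall>k\<in>{1..<n}. \<omega> k = \<omega>' k)"
proof (induction n)
  case 0
  show ?case by (simp add: digit_sum_def)
next
  case (Suc n)
  have *: "digit_sum \<upsilon> (Suc n) = digit_sum \<upsilon> n + of_bool (n = 0 \<or> \<upsilon> n) * 2 ^ n" for \<upsilon>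
    by (simp add: digit_sum_def)
  have "digit_sum \<omega> (Suc n) = digit_sum \<omega>' (Suc n) \<longleftrightarrow>
      digit_sum \<omega> n = digit_sum \<omega>' n \<and> (n = 0 \<or> \<omega> n \<longleftrightarrow> n = 0 \<or> \<omega>' n)"
    using digit_sum_bounds[of \<omega> n] digit_sum_bounds[of \<omega>' n]
    unfolding * by (auto split: if_splits)
  also have "\<dots> \<longleftrightarrow> (\<forall>k\<in>{1..<Suc n}. \<omega> k = \<omega>' k)"
    unfolding Suc.IH by (auto simp: less_Suc_eq)
  finally show ?case .
qed

lemma digit_sum_surj:
  assumes "x \<in> two_adic_units"
  shows "\<exists>\<omega>. digit_sum \<omega> n = residue x n"
proof (induction n)
  case 0
  show ?case using residue_mod[of x 0] by (simp add: digit_sum_def)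
next
  case (Suc n)
  then obtain \<omega> where \<omega>: "digit_sum \<omega> n = residue x n" ..
  define q where "q = residue x (Suc n) div 2 ^ n"
  have x: "residue x (Suc n) = residue x n + q * 2 ^ n"
    unfolding q_def using residue_coherent[of x n] by (metis mod_div_mult_eq)
  have bounds: "0 \<le> residue x (Suc n)" "residue x (Suc n) < 2 * 2 ^ n"
    using residue_mod[of x "Suc n"] pos_mod_bound[of "2 ^ Suc n" "residue x (Suc n)"]
      pos_mod_sign[of "2 ^ Suc n" "residue x (Suc n)"] by simp_all
  have "0 \<le> residue x n"
    using residue_mod[of x n] pos_mod_sign[of "2 ^ n" "residue x n"] by simp
  then have "q * 2 ^ n < 2 * 2 ^ n"
    using bounds(2) x by linarith
  then have "q < 2" by simp
  have "0 \<le> q"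
    unfolding q_def using bounds(1) by (simp add: pos_imp_zdiv_nonneg_iff)
  then have q: "q = 0 \<or> q = 1" using \<open>q < 2\<close> by linarith
  let ?\<omega> = "\<lambda>k. if k = n then q = 1 else \<omega> k"
  have "digit_sum ?\<omega> n = residue x n"
    unfolding \<omega>[symmetric] digit_sum_eq_iff by auto
  moreover have "n = 0 \<Longrightarrow> q = 1"
    using x assms residue_mod[of x 0] by (simp add: two_adic_units_iff)
  ultimately have "digit_sum ?\<omega> (Suc n) = residue x (Suc n)"
    using q unfolding x by (auto simp: digit_sum_def)
  then show ?case by blast
qed

definition coin_flips :: "(nat \<Rightarrow> bool) measure" where
  "coin_flips = (\<Pi>\<^sub>M i\<in>UNIV. measure_pmf (bernoulli_pmf (1 / 2)))"

lemma space_coin_flips: "space coin_flips = UNIV"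
  by (simp add: coin_flips_def space_PiM PiE_UNIV_domain)

lemma coin_flips_cylinder:
  shows "{\<omega>. \<forall>k\<in>{1..<n}. \<omega> k = \<omega>' k} \<in> sets coin_flips" (is ?A)
    and "emeasure coin_flips {\<omega>. \<forall>k\<in>{1..<n}. \<omega> k = \<omega>' k} = (1 / 2) ^ (n - 1)" (is ?B)
proof -
  interpret product_prob_space "\<lambda>_ :: nat. measure_pmf (bernoulli_pmf (1 / 2))" UNIV ..
  have eq: "{\<omega>. \<forall>k\<in>{1..<n}. \<omega> k = \<omega>' k} =
      {\<omega> \<in> space (\<Pi>\<^sub>M i\<in>UNIV. measure_pmf (bernoulli_pmf (1 / 2))). \<forall>k\<in>{1..<n}. \<omega> k \<in> {\<omega>' k}}"
    by (simp add: space_PiM PiE_UNIV_domain)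
  have "{\<omega> \<in> space (\<Pi>\<^sub>M i\<in>UNIV. measure_pmf (bernoulli_pmf (1 / 2))). \<omega> k \<in> {\<omega>' k}}
      \<in> sets (\<Pi>\<^sub>M i\<in>UNIV. measure_pmf (bernoulli_pmf (1 / 2)))" for k :: nat
    using measurable_sets[OF measurable_component_singleton[of k UNIV
          "\<lambda>_. measure_pmf (bernoulli_pmf (1 / 2))"], of "{\<omega>' k}"]
    by (simp add: vimage_def Int_def conj_commute)
  then show ?A
    unfolding eq coin_flips_def by (intro sets.sets_Collect_finite_All) auto
  have "emeasure coin_flips {\<omega>. \<forall>k\<in>{1..<n}. \<omega> k = \<omega>' k} =
      (\<Prod>k\<in>{1..<n}. emeasure (measure_pmf (bernoulli_pmf (1 / 2))) {\<omega>' k})"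
    unfolding eq coin_flips_def by (rule emeasure_PiM_Collect) auto
  also have "\<dots> = (\<Prod>k\<in>{1..<n}. 1 / 2)"
  proof (rule prod.cong)
    fix k
    have "ennreal (1 / 2) = 1 / 2"
      by (simp add: divide_ennreal_def)
    then show "emeasure (measure_pmf (bernoulli_pmf (1 / 2))) {\<omega>' k} = 1 / 2"
      by (cases "\<omega>' k") (simp_all add: emeasure_pmf_single)
  qed simp
  finally show ?B by simp
qed

lemma vimage_unit_of_digits:
  assumes "x \<in> two_adic_units"
  shows "\<exists>\<omega>'. unit_of_digits -` residue_ball n (residue x n) = {\<omega>. \<forall>k\<in>{1..<n}. \<omega> k = \<omega>' k}"
proof -
  obtain \<omega>' where \<omega>': "digit_sum \<omega>' n = residue x n"
    using digit_sum_surj[OF assms] ..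
  have "unit_of_digits -` residue_ball n (residue x n) = {\<omega>. digit_sum \<omega> n = digit_sum \<omega>' n}"
    by (simp add: \<omega>' residue_ball_def unit_of_digits residue_unit_of_digits vimage_def)
  then show ?thesis
    unfolding digit_sum_eq_iff by blast
qed

lemma residue_ball_cases:
  obtains "residue_ball n a = {}" | x where "x \<in> two_adic_units" "a = residue x n"
  by (auto simp: residue_ball_def)

lemma measurable_unit_of_digits:
  "unit_of_digits \<in> measurable coin_flips (restrict_space borel two_adic_units)"
proof (rule measurable_two_adic_units)
  fix n a
  show "unit_of_digits -` residue_ball n a \<inter> space coin_flips \<in> sets coin_flips"
  proof (cases n a rule: residue_ball_cases)
    case (2 x)
    then show ?thesis
      using vimage_unit_of_digits[of x n] coin_flips_cylinder(1)[of n]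
      by (auto simp: space_coin_flips)
  qed simp
qed (simp add: unit_of_digits)

lemma normalized_haar_coin_flips:
  "normalized_haar two_adic_units
     (distr coin_flips (restrict_space borel two_adic_units) unit_of_digits)"
proof -
  let ?U = two_adic_units
  let ?B = "restrict_space borel ?U"
  let ?\<mu> = "distr coin_flips ?B unit_of_digits"
  have space_B: "space ?B = ?U" by (simp add: space_restrict_space)
  have mult: "x * y \<in> ?U" if "x \<in> ?U" "y \<in> ?U" for x y
    using that mult_dvd_mono[of x 1 y 1] by (simp add: two_adic_units_def)
  have ball_sets: "residue_ball n a \<in> sets ?B" for n a
    unfolding sets_borel_two_adic_units by (rule sigma_sets.Basic) auto
  interpret coin_flips: prob_space coin_flips
    unfolding coin_flips_def by (intro prob_space_PiM prob_space_measure_pmf)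
  have prob: "prob_space ?\<mu>"
    by (rule coin_flips.prob_space_distr[OF measurable_unit_of_digits])
  have ball: "emeasure ?\<mu> (residue_ball n (residue x n)) = (1 / 2) ^ (n - 1)" if "x \<in> ?U" for x n
    using vimage_unit_of_digits[OF that, of n] coin_flips_cylinder(2)[of n]
    by (auto simp: emeasure_distr[OF measurable_unit_of_digits ball_sets] space_coin_flips)
  have "emeasure ?\<mu> ((\<lambda>x. g * x) ` A) = emeasure ?\<mu> A" if g: "g \<in> ?U" and A: "A \<in> sets ?B" for g A
  proof -
    obtain h where gh: "g * h = 1" using g by (metis dvdE mem_Collect_eq two_adic_units_def)
    then have h: "h \<in> ?U"
      by (metis dvd_triv_right mem_Collect_eq two_adic_units_def)
    have cancel: "g * (h * x) = x" "h * (g * x) = x" for x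
      using gh by (metis mult.assoc mult.commute mult.right_neutral)+
    have pre: "(\<lambda>x. h * x) -` residue_ball n (residue x n) \<inter> ?U = residue_ball n (residue (g * x) n)"
      for x n
    proof -
      have "residue (h * y) n = residue x n \<longleftrightarrow> residue y n = residue (g * x) n" for y
        using cancel(1)[of y] cancel(2)[of x] residue_times[of g "h * y" n] residue_times[of g x n]
          residue_times[of h y n] residue_times[of h "g * x" n]
        by metis
      then show ?thesis
        using mult[OF h] by (auto simp: residue_ball_def)
    qed
    have meas: "(\<lambda>x. h * x) \<in> measurable ?\<mu> ?B"
    proof (rule measurable_two_adic_units)
      fix n a
      show "(\<lambda>x. h * x) -` residue_ball n a \<inter> space ?\<mu> \<in> sets ?\<mu>"
        by (cases n a rule: residue_ball_cases) (simp_all add: space_B pre ball_sets)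
    qed (use mult[OF h] in \<open>simp add: space_B\<close>)
    have "?\<mu> = distr ?\<mu> ?B (\<lambda>x. h * x)"
    proof (rule two_adic_units_measure_eqI[OF _ _ prob])
      fix n a
      have "emeasure (distr ?\<mu> ?B (\<lambda>x. h * x)) (residue_ball n a) =
          emeasure ?\<mu> ((\<lambda>x. h * x) -` residue_ball n a \<inter> ?U)"
        using emeasure_distr[OF meas ball_sets] by (simp add: space_B)
      then show "emeasure ?\<mu> (residue_ball n a) =
          emeasure (distr ?\<mu> ?B (\<lambda>x. h * x)) (residue_ball n a)"
        by (cases n a rule: residue_ball_cases) (simp_all add: pre ball mult g)
    qed simp_all
    then have "emeasure ?\<mu> A = emeasure (distr ?\<mu> ?B (\<lambda>x. h * x)) A" by simp
    also have "\<dots> = emeasure ?\<mu> ((\<lambda>x. h * x) -` A \<inter> ?U)"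
      using emeasure_distr[OF meas, of A] A by (simp add: space_B)
    also have "(\<lambda>x. h * x) -` A \<inter> ?U = (\<lambda>x. g * x) ` A"
    proof -
      have "A \<subseteq> ?U" using sets.sets_into_space[OF A] by (simp add: space_B)
      then show ?thesis
        using mult[OF g] cancel by (auto simp: image_iff) (metis cancel(1))
    qed
    finally show ?thesis ..
  qed
  then show ?thesis
    using prob by (simp add: normalized_haar_def)
qed

text \<open>The property depends on the factors \<open>p 1, \<dots>, p r\<close>, not only on their product.\<close>

definition two_korselt :: "nat \<Rightarrow> (nat \<Rightarrow> two_adic) \<Rightarrow> bool" where
  "two_korselt r p \<longleftrightarrow>
     two_adic_valuation ((\<Prod>i=1..r. p i) - 1) \<ge> (MAX i\<in>{1..r}. two_adic_valuation (p i - 1))"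

end

theory Submission
  imports Defs
begin

text \<open>
  Let \<open>P\<close> be the product, \<open>k\<close> the least valuation of the \<open>p i - 1\<close> and \<open>S\<close> the set of indices where
  it is attained. If \<open>S\<close> contains all indices then \<open>P\<close> is Korselt. Otherwise, since modulo
  \<open>2 ^ (k + 1)\<close> the product is \<open>1 + card S * 2 ^ k\<close>, a Korselt product requires \<open>card S\<close> to be even. In that case \<open>P - 1\<close> has some valuation \<open>k + w\<close>
  with \<open>w \<ge> 1\<close> (almost surely \<open>P \<noteq> 1\<close>), and \<open>P\<close> is Korselt iff the valuations of the
  \<open>p i - 1\<close> outside \<open>S\<close> lie in \<open>{k<..k + w}\<close>. Multiplying by a factor \<open>p i\<close> with \<open>i \<in> S\<close>, which is Haar
  distributed and independent of the others, makes \<open>P\<close> equidistributed modulo \<open>2 ^ (k + w + 1)\<close>,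
  whence the event has probability \<open>2 ^ (- k r) 2 ^ (- w) (1 - 2 ^ (- w)) ^ (r - card S)\<close>. It remains
  to sum geometric series over \<open>k\<close> and, after binomial expansion, over \<open>w\<close>.
\<close>

section \<open>The filtration of the unit group by principal units\<close>

abbreviation units_borel :: "two_adic measure" where
  "units_borel \<equiv> restrict_space borel two_adic_units"

text \<open>For \<open>n \<ge> 1\<close> this is the congruence subgroup of level \<open>n\<close>.
  Bounds on the valuation of \<open>x - 1\<close> become memberships in a decreasing chain of sets,
  which avoids arithmetic with infinite valuations.\<close>

definition principal_units :: "nat \<Rightarrow> two_adic set" where
  "principal_units n = {x \<in> two_adic_units. 2 ^ n dvd x - 1}"

lemma two_adic_units_mult: "x \<in> two_adic_units \<Longrightarrow> y \<in> two_adic_units \<Longrightarrow> x * y \<in> two_adic_units"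
  using mult_dvd_mono[of x 1 y 1] by (simp add: two_adic_units_def)

lemma two_adic_units_prod: "(\<And>i. i \<in> I \<Longrightarrow> x i \<in> two_adic_units) \<Longrightarrow> prod x I \<in> two_adic_units"
  by (induction I rule: infinite_finite_induct) (auto simp: two_adic_units_mult, auto simp: two_adic_units_def)

lemma principal_units_eq_residue_ball: "principal_units n = residue_ball n (residue 1 n)"
  by (auto simp: principal_units_def residue_ball_def two_power_dvd_diff_iff)

text \<open>Units are odd, so \<open>x - 1\<close> is always even. Valuations of interest thus start
  at \<open>Suc 0\<close>, and a counter \<open>k\<close> from 0 stands for the valuation
  \<open>Suc k\<close>.\<close>

lemma principal_units_one: "principal_units (Suc 0) = two_adic_units"
proof -
  have "x \<in> two_adic_units \<longleftrightarrow> 2 ^ Suc 0 dvd x - 1" for x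
    unfolding two_power_dvd_diff_iff by (simp add: two_adic_units_iff residue_one)
  then show ?thesis by (auto simp: principal_units_def)
qed

lemma principal_units_antimono: "m \<le> n \<Longrightarrow> principal_units n \<subseteq> principal_units m"
  by (auto simp: principal_units_def intro: dvd_trans le_imp_power_dvd)

text \<open>Any residue at a level \<open>m \<ge> n\<close> decides membership, so two neighbouring
  levels can be compared on one and the same integer.\<close>

lemma principal_units_iff_residue:
  assumes "x \<in> two_adic_units" "n \<le> m"
  shows "x \<in> principal_units n \<longleftrightarrow> 2 ^ n dvd residue x m - 1"
proof -
  have "x \<in> principal_units n \<longleftrightarrow> residue x m mod 2 ^ n = 1 mod 2 ^ n"
    using assms
    by (simp only: principal_units_def two_power_dvd_diff_iff residue_mod_le residue_one
        mem_Collect_eq simp_thms)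
  then show ?thesis by (simp only: mod_eq_dvd_iff)
qed

lemma two_power_Suc_dvd_mult_iff: "(2 :: int) ^ Suc k dvd 2 ^ k * c \<longleftrightarrow> even c"
  by (simp add: power_Suc2 del: power_Suc)

text \<open>Write \<open>x = 1 + 2 ^ Suc k * a\<close> and \<open>y = 1 + 2 ^ Suc k * b\<close>. As
  the exponent is at least 1, the cross term vanishes modulo \<open>2 ^ Suc (Suc k)\<close>, and
  only the parity of \<open>a + b\<close> remains.\<close>

lemma dvd_mult_minus_one_iff:
  fixes x y :: int
  assumes x: "2 ^ Suc k dvd x - 1" and y: "2 ^ Suc k dvd y - 1"
  shows "2 ^ Suc (Suc k) dvd x * y - 1 \<longleftrightarrow>
    (2 ^ Suc (Suc k) dvd x - 1 \<longleftrightarrow> 2 ^ Suc (Suc k) dvd y - 1)"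
proof -
  obtain a where a: "x - 1 = 2 ^ Suc k * a" using x by blast
  obtain b where b: "y - 1 = 2 ^ Suc k * b" using y by blast
  have ab: "x * y - 1 = 2 ^ Suc k * (a + b + 2 * (2 ^ k * a * b))"
  proof -
    have "x = 1 + 2 ^ Suc k * a" "y = 1 + 2 ^ Suc k * b" using a b by simp_all
    then show ?thesis by (simp add: algebra_simps)
  qed
  show ?thesis
    unfolding a b ab two_power_Suc_dvd_mult_iff by simp
qed

lemma principal_units_mult:
  assumes "x \<in> principal_units n" "y \<in> principal_units n"
  shows "x * y \<in> principal_units n"
proof -
  have "2 ^ n dvd x * (y - 1) + (x - 1)"
    using assms by (intro dvd_add dvd_mult) (auto simp: principal_units_def)
  also have "x * (y - 1) + (x - 1) = x * y - 1" by (simp add: algebra_simps)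
  finally show ?thesis
    using assms by (simp add: principal_units_def two_adic_units_mult)
qed

lemma principal_units_prod:
  "(\<And>i. i \<in> I \<Longrightarrow> x i \<in> principal_units n) \<Longrightarrow> prod x I \<in> principal_units n"
  by (induction I rule: infinite_finite_induct)
     (auto simp: principal_units_mult, auto simp: principal_units_def two_adic_units_def)

lemma principal_units_Suc_mult_iff:
  assumes "x \<in> principal_units (Suc k)" "y \<in> principal_units (Suc k)"
  shows "x * y \<in> principal_units (Suc (Suc k)) \<longleftrightarrow>
    (x \<in> principal_units (Suc (Suc k)) \<longleftrightarrow> y \<in> principal_units (Suc (Suc k)))"
proof -
  let ?n = "Suc (Suc k)"
  have units: "x \<in> two_adic_units" "y \<in> two_adic_units" "x * y \<in> two_adic_units"
    using assms by (auto simp: principal_units_def two_adic_units_mult)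
  have "x * y \<in> principal_units ?n \<longleftrightarrow> 2 ^ ?n dvd residue x ?n * residue y ?n mod 2 ^ ?n - 1"
    by (simp only: principal_units_iff_residue[OF units(3) order_refl] residue_times)
  also have "\<dots> \<longleftrightarrow> 2 ^ ?n dvd residue x ?n * residue y ?n - 1"
    by (metis mod_eq_dvd_iff mod_mod_trivial)
  also have "\<dots> \<longleftrightarrow> (2 ^ ?n dvd residue x ?n - 1 \<longleftrightarrow> 2 ^ ?n dvd residue y ?n - 1)"
    using assms units principal_units_iff_residue[of _ "Suc k" ?n]
    by (intro dvd_mult_minus_one_iff) simp_all
  finally show ?thesis
    by (simp only: principal_units_iff_residue[OF _ order_refl] units)
qed

text \<open>The quotient of these two levels has order 2, so a product is trivial there iff an even
  number of factors is not. This is the source of the parity condition on \<open>S\<close>.\<close>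

lemma principal_units_Suc_prod_iff:
  assumes "finite I" "\<And>i. i \<in> I \<Longrightarrow> x i \<in> principal_units (Suc k)"
  shows "prod x I \<in> principal_units (Suc (Suc k)) \<longleftrightarrow>
    even (card {i \<in> I. x i \<notin> principal_units (Suc (Suc k))})"
  using assms
proof (induction I rule: finite_induct)
  case empty
  show ?case by (simp add: principal_units_def two_adic_units_def)
next
  case (insert j I)
  have "{i \<in> insert j I. x i \<notin> principal_units (Suc (Suc k))} =
      (if x j \<in> principal_units (Suc (Suc k)) then {i \<in> I. x i \<notin> principal_units (Suc (Suc k))}
       else insert j {i \<in> I. x i \<notin> principal_units (Suc (Suc k))})"
    by auto
  moreover have "x j * prod x I \<in> principal_units (Suc (Suc k)) \<longleftrightarrow>
      (x j \<in> principal_units (Suc (Suc k)) \<longleftrightarrow> prod x I \<in> principal_units (Suc (Suc k)))"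
    using insert.prems by (intro principal_units_Suc_mult_iff principal_units_prod) auto
  ultimately show ?case
    using insert by simp
qed

section \<open>Valuations and the shape of Korselt tuples\<close>

lemma Inter_principal_units: "(\<Inter>n. principal_units n) = {1}"
proof -
  have "x = 1" if "\<And>n. x \<in> principal_units n" for x
    using that by (intro two_adic_eqI) (auto simp: principal_units_def two_power_dvd_diff_iff)
  then show ?thesis by (auto simp: principal_units_def two_adic_units_def)
qed

text \<open>The exponents \<open>n\<close> with \<open>2 ^ n dvd x\<close> are closed downwards. If
  \<open>n\<close> is not among them, all are below \<open>n\<close> and their supremum is at most
  \<open>n - 1\<close>.\<close>

lemma le_two_adic_valuation_iff: "enat n \<le> two_adic_valuation x \<longleftrightarrow> 2 ^ n dvd x"
proof
  assume "2 ^ n dvd x"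
  then show "enat n \<le> two_adic_valuation x"
    unfolding two_adic_valuation_def by (intro SUP_upper) simp
next
  assume le: "enat n \<le> two_adic_valuation x"
  show "2 ^ n dvd x"
  proof (rule ccontr)
    assume not: "\<not> 2 ^ n dvd x"
    then have "n \<noteq> 0" by (metis one_dvd power_0)
    have "m < n" if "2 ^ m dvd x" for m
      using that not by (meson dvd_trans le_imp_power_dvd not_less)
    then have "two_adic_valuation x \<le> enat (n - 1)"
      unfolding two_adic_valuation_def by (intro SUP_least) fastforce
    with le have "enat n \<le> enat (n - 1)" by (rule order_trans)
    with \<open>n \<noteq> 0\<close> show False by simp
  qed
qed

text \<open>An element of \<open>enat\<close> is determined by the finite numbers below it, so
  infinite valuations need no separate treatment.\<close>

lemma two_adic_valuation_le_iff:
  "two_adic_valuation x \<le> two_adic_valuation y \<longleftrightarrow> (\<forall>n. 2 ^ n dvd x \<longrightarrow> 2 ^ n dvd y)"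
proof -
  have "a \<le> b" if "\<And>n. enat n \<le> a \<Longrightarrow> enat n \<le> b" for a b :: enat
  proof (cases b)
    case (enat m)
    have "\<not> enat m < a"
      using that[of "Suc m"] unfolding Suc_ile_eq enat by blast
    then show ?thesis using enat by simp
  qed simp
  then have *: "a \<le> b \<longleftrightarrow> (\<forall>n. enat n \<le> a \<longrightarrow> enat n \<le> b)" for a b :: enat
    using order_trans by blast
  show ?thesis
    unfolding *[of "two_adic_valuation x"] le_two_adic_valuation_iff ..
qed

text \<open>The maximum over the factors turns into a universal quantifier;
  \<open>r \<noteq> 0\<close> keeps the index set of \<open>MAX\<close> nonempty.\<close>

lemma two_korselt_iff:
  assumes "r \<noteq> 0" "\<And>i. i \<in> {1..r} \<Longrightarrow> x i \<in> two_adic_units"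
  shows "two_korselt r x \<longleftrightarrow>
    (\<forall>i\<in>{1..r}. \<forall>n. x i \<in> principal_units n \<longrightarrow> prod x {1..r} \<in> principal_units n)"
  using assms two_adic_units_prod[of "{1..r}" x]
  by (auto simp: two_korselt_def two_adic_valuation_le_iff principal_units_def)

text \<open>
  In the third case \<open>Suc k\<close> is the least valuation of the \<open>x i - 1\<close>, attained exactly on \<open>S\<close>, and
  \<open>Suc k + Suc w\<close> is the valuation of \<open>prod x {1..r} - 1\<close>.
\<close>

lemma two_korselt_cases:
  assumes "r \<noteq> 0" and units: "\<And>i. i \<in> {1..r} \<Longrightarrow> x i \<in> two_adic_units"
  shows "two_korselt r x \<longleftrightarrow> prod x {1..r} = 1 \<or>
    (\<exists>k. \<forall>i\<in>{1..r}. x i \<in> principal_units (Suc k) - principal_units (Suc (Suc k))) \<or>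
    (\<exists>S\<in>{S. S \<subset> {1..r} \<and> S \<noteq> {} \<and> even (card S)}. \<exists>k w.
      prod x {1..r} \<in> principal_units (Suc k + Suc w) - principal_units (Suc (Suc k + Suc w)) \<and>
      (\<forall>i\<in>S. x i \<in> principal_units (Suc k) - principal_units (Suc (Suc k))) \<and>
      (\<forall>i\<in>{1..r} - S. x i \<in> principal_units (Suc (Suc k)) - principal_units (Suc (Suc k + Suc w))))"
    (is "_ \<longleftrightarrow> ?one \<or> (\<exists>k. ?A k) \<or> (\<exists>S\<in>?E. \<exists>k w. ?B S k w)")
proof
  let ?U = principal_units and ?P = "prod x {1..r}"
  assume "two_korselt r x"
  note all = two_korselt_iff[THEN iffD1, OF assms this]
  have kor: "?P \<in> ?U n" if "i \<in> {1..r}" "x i \<in> ?U n" for i n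
    using that all by simp
  show "?one \<or> (\<exists>k. ?A k) \<or> (\<exists>S\<in>?E. \<exists>k w. ?B S k w)"
  proof (cases "?P = 1")
    case False
    \<comment> \<open>Only 1 lies in every level, so the levels containing \<open>?P\<close> are
      bounded. The greatest one, \<open>V\<close> below, is the valuation of
      \<open>?P - 1\<close>.\<close>
    then obtain N where N: "?P \<notin> ?U N" using Inter_principal_units by blast
    have ge: "n < N" if "?P \<in> ?U n" for n
      using that N principal_units_antimono[of N n] by (meson linorder_not_less subsetD)
    have P1: "?P \<in> ?U (Suc 0)"
      unfolding principal_units_one by (rule two_adic_units_prod[OF units])
    define V where "V = (GREATEST n. ?P \<in> ?U n)"
    have V: "?P \<in> ?U V"
      unfolding V_def by (rule GreatestI_nat[where P = "\<lambda>n. ?P \<in> ?U n", OF P1])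
        (rule less_imp_le[OF ge])
    have V_ge: "n \<le> V" if "?P \<in> ?U n" for n
      unfolding V_def by (rule Greatest_le_nat[where P = "\<lambda>n. ?P \<in> ?U n", OF that])
        (rule less_imp_le[OF ge])
    define Q where "Q n \<longleftrightarrow> (\<forall>i\<in>{1..r}. x i \<in> ?U n)" for n
    have Q1: "Q (Suc 0)" unfolding Q_def principal_units_one using units by blast
    \<comment> \<open>The Korselt property for the factor of index 1 bounds the levels common to all
      factors by \<open>V\<close>. Hence the least valuation \<open>K\<close> exists.\<close>
    have Q_le: "n \<le> V" if "Q n" for n
      using that kor[of 1 n] V_ge \<open>r \<noteq> 0\<close> by (auto simp: Q_def)
    define K where "K = (GREATEST n. Q n)"
    have K: "Q K"
      unfolding K_def by (rule GreatestI_nat[where P = Q, OF Q1 Q_le])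
    have K_ge: "n \<le> K" if "Q n" for n
      unfolding K_def by (rule Greatest_le_nat[where P = Q, OF that Q_le])
    obtain k where k: "K = Suc k" using K_ge[OF Q1] by (metis Suc_le_D)
    define S where "S = {i \<in> {1..r}. x i \<notin> ?U (Suc K)}"
    \<comment> \<open>Were \<open>S\<close> empty, all factors would reach level
      \<open>Suc K\<close>, against the maximality of \<open>K\<close>.\<close>
    have "S \<noteq> {}" using K_ge[of "Suc K"] unfolding Q_def S_def by fastforce
    have on_S: "x i \<in> ?U K - ?U (Suc K)" if "i \<in> S" for i
      using that K by (auto simp: S_def Q_def)
    show ?thesis
    proof (cases "S = {1..r}")
      case True
      then have "?A k" using on_S k by blast
      then show ?thesis by blast
    next
      case False
      \<comment> \<open>A factor outside \<open>S\<close> reaches level \<open>Suc K\<close>, and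
        the Korselt property carries \<open>?P\<close> along. Hence \<open>V\<close> exceeds
        \<open>K\<close> by some \<open>Suc w\<close>, and \<open>card S\<close> is even.\<close>
      then have "\<exists>j\<in>{1..r}. x j \<in> ?U (Suc K)" unfolding S_def by blast
      then obtain j where j: "j \<in> {1..r}" "x j \<in> ?U (Suc K)" by blast
      then have P: "?P \<in> ?U (Suc K)" by (rule kor)
      then obtain w where w: "V = Suc k + Suc w"
        using V_ge[OF P] k by (metis add_Suc_right add_Suc_shift le_Suc_ex)
      have "even (card S)"
        using P principal_units_Suc_prod_iff[of "{1..r}" x k] K unfolding S_def k Q_def by simp
      then have "S \<in> ?E" using \<open>S \<noteq> {}\<close> False by (auto simp: S_def)
      moreover have "?B S k w"
      proof (intro conjI ballI)
        show "?P \<in> ?U (Suc k + Suc w) - ?U (Suc (Suc k + Suc w))"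
          using V V_ge[of "Suc V"] unfolding w by auto
        fix i
        show "x i \<in> ?U (Suc k) - ?U (Suc (Suc k))" if "i \<in> S" using on_S that k by simp
        \<comment> \<open>A factor at level \<open>Suc V\<close> would put \<open>?P\<close> there
          too, against the maximality of \<open>V\<close>.\<close>
        show "x i \<in> ?U (Suc (Suc k)) - ?U (Suc (Suc k + Suc w))" if "i \<in> {1..r} - S"
          using that kor[of i "Suc V"] V_ge[of "Suc V"] unfolding S_def k w by auto
      qed
      ultimately show ?thesis by blast
    qed
  qed simp
next
  let ?U = principal_units and ?P = "prod x {1..r}"
  have le: "n \<le> m" if "y \<in> ?U n" "y \<notin> ?U (Suc m)" for y n m
    using that principal_units_antimono[of "Suc m" n] by (meson not_less_eq_eq subsetD)
  \<comment> \<open>It suffices to find a level that \<open>?P\<close> reaches and no factor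
    exceeds: \<open>Suc k\<close> in the second case, \<open>Suc k + Suc w\<close> in the
    third.\<close>
  have korI: "two_korselt r x"
    if "?P \<in> ?U m" "\<And>i n. i \<in> {1..r} \<Longrightarrow> x i \<in> ?U n \<Longrightarrow> n \<le> m" for m
  proof (rule two_korselt_iff[THEN iffD2, OF assms])
    show "\<forall>i\<in>{1..r}. \<forall>n. x i \<in> ?U n \<longrightarrow> ?P \<in> ?U n"
    proof (intro ballI allI impI)
      fix i n assume "i \<in> {1..r}" "x i \<in> ?U n"
      then show "?P \<in> ?U n"
        using that(1) that(2)[of i n] principal_units_antimono[of n m] by (meson subsetD)
    qed
  qed
  assume "?one \<or> (\<exists>k. ?A k) \<or> (\<exists>S\<in>?E. \<exists>k w. ?B S k w)"
  then show "two_korselt r x"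
  proof (elim disjE exE bexE)
    assume ?one
    then have "?P \<in> ?U n" for n
      using Inter_principal_units by auto
    then show ?thesis
      by (intro two_korselt_iff[THEN iffD2, OF assms] ballI allI impI)
  next
    fix k assume A: "?A k"
    then have "?P \<in> ?U (Suc k)" by (intro principal_units_prod) auto
    then show ?thesis
      by (rule korI) (metis A DiffD2 le)
  next
    fix S k w assume B: "?B S k w"
    have "n \<le> Suc k + Suc w" if "i \<in> {1..r}" "x i \<in> ?U n" for i n
    proof (cases "i \<in> S")
      case True
      then have "x i \<notin> ?U (Suc (Suc k))" using B by blast
      then show ?thesis using le[OF that(2), of "Suc k"] by simp
    next
      case False
      then have "x i \<notin> ?U (Suc (Suc k + Suc w))" using B that(1) by blast
      then show ?thesis by (rule le[OF that(2)])
    qed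
    then show ?thesis
      using B by (intro korI[of "Suc k + Suc w"]) blast+
  qed
qed

section \<open>Measurability on the unit group\<close>

lemma space_units_borel: "space units_borel = two_adic_units"
  by (simp add: space_restrict_space)

lemma one_two_adic_units: "1 \<in> two_adic_units"
  by (simp add: two_adic_units_def)

lemma disjoint_family_on_residue_ball: "disjoint_family_on (residue_ball n) I"
  by (auto simp: disjoint_family_on_def residue_ball_def)

lemma sets_residue_ball [measurable]: "residue_ball n a \<in> sets units_borel"
  unfolding sets_borel_two_adic_units by (rule sigma_sets.Basic) auto

lemma sets_principal_units [measurable]: "principal_units n \<in> sets units_borel"
  unfolding principal_units_eq_residue_ball by (rule sets_residue_ball)

lemma residue_in_range: "residue x n \<in> {0..<2 ^ n}"
  using pos_mod_bound[of "2 ^ n" "residue x n"] pos_mod_sign[of "2 ^ n" "residue x n"]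
  unfolding residue_mod by simp

text \<open>The residue of a product depends only on the residues of its factors, so the preimage of
  a ball is a finite union over pairs of residues with the right product.\<close>

lemma measurable_units_mult:
  assumes f: "f \<in> measurable M units_borel" and g: "g \<in> measurable M units_borel"
  shows "(\<lambda>\<omega>. f \<omega> * g \<omega>) \<in> measurable M units_borel"
proof (rule measurable_two_adic_units)
  have fg: "f \<omega> \<in> two_adic_units" "g \<omega> \<in> two_adic_units" if "\<omega> \<in> space M" for \<omega>
    using measurable_space[OF f that] measurable_space[OF g that] by (auto simp: space_units_borel)
  then show "(\<lambda>\<omega>. f \<omega> * g \<omega>) \<in> space M \<rightarrow> two_adic_units"
    by (simp add: two_adic_units_mult)
  fix n :: nat and a :: int
  let ?I = "{bc \<in> {0..<2 ^ n} \<times> {0..<2 ^ n}. fst bc * snd bc mod 2 ^ n = a}"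
  have "(\<lambda>\<omega>. f \<omega> * g \<omega>) -` residue_ball n a \<inter> space M =
      (\<Union>bc\<in>?I. (f -` residue_ball n (fst bc) \<inter> space M) \<inter> (g -` residue_ball n (snd bc) \<inter> space M))"
    using residue_in_range fg by (auto simp: residue_ball_def residue_times two_adic_units_mult)
  also have "\<dots> \<in> sets M"
  proof (rule sets.finite_UN)
    show "finite ?I" by (rule finite_subset[of _ "{0..<2 ^ n} \<times> {0..<2 ^ n}"]) auto
  qed (intro sets.Int measurable_sets[OF f] measurable_sets[OF g] sets_residue_ball)
  finally show "(\<lambda>\<omega>. f \<omega> * g \<omega>) -` residue_ball n a \<inter> space M \<in> sets M" .
qed

lemma measurable_units_prod:
  assumes "\<And>i. i \<in> I \<Longrightarrow> f i \<in> measurable M units_borel"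
  shows "(\<lambda>\<omega>. \<Prod>i\<in>I. f i \<omega>) \<in> measurable M units_borel"
  using assms
proof (induction I rule: infinite_finite_induct)
  case (insert i I)
  then show ?case by (simp add: measurable_units_mult)
qed (simp_all add: space_units_borel one_two_adic_units)

section \<open>Haar measure of residue classes and equidistribution of products\<close>

lemma residue_of_int: "residue (of_int a) n = a mod 2 ^ n"
proof -
  have nat: "residue (of_nat k) n = int k mod 2 ^ n" for k
  proof (induction k)
    case 0
    show ?case by (simp add: zero_two_adic.rep_eq)
  next
    case (Suc k)
    then show ?case by (simp add: plus_two_adic.rep_eq residue_one mod_add_eq del: one_mod_2_pow_eq)
  qed
  show ?thesis
  proof (cases a rule: int_cases2)
    case (nonneg k)
    then show ?thesis by (simp add: nat)
  next
    case (nonpos k)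
    then show ?thesis by (simp add: uminus_two_adic.rep_eq nat mod_minus_eq)
  qed
qed

lemma of_int_two_adic_unit_iff: "of_int a \<in> two_adic_units \<longleftrightarrow> odd a"
  unfolding two_adic_units_iff residue_of_int by (simp add: odd_iff_mod_2_eq_one)

lemma two_adic_units_inverse:
  assumes "x \<in> two_adic_units"
  obtains y where "y \<in> two_adic_units" "x * y = 1"
  using assms by (metis dvdE dvd_triv_right mem_Collect_eq two_adic_units_def)

text \<open>Nonempty balls of one level are translates of the ball around 1, the inverse of
  \<open>x\<close> giving the converse inclusion. This brings the invariance of Haar measure to bear
  on them.\<close>

lemma mult_residue_ball:
  assumes "x \<in> two_adic_units"
  shows "(\<lambda>y. x * y) ` residue_ball n (residue 1 n) = residue_ball n (residue x n)"
proof -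
  obtain x' where x': "x' \<in> two_adic_units" "x * x' = 1"
    using two_adic_units_inverse[OF assms] .
  have "z \<in> (\<lambda>y. x * y) ` residue_ball n (residue 1 n)" if "z \<in> residue_ball n (residue x n)" for z
  proof
    show "z = x * (x' * z)" using x' by (metis mult.assoc mult_1)
    have "residue (x' * z) n = residue (x' * x) n"
      using that by (simp add: residue_ball_def residue_times)
    then show "x' * z \<in> residue_ball n (residue 1 n)"
      using that x' by (simp add: residue_ball_def two_adic_units_mult mult.commute)
  qed
  moreover have "residue (x * y) n = residue x n" if "residue y n = residue 1 n" for y
    using that by (metis residue_times mult_1_right)
  ultimately show ?thesis
    using assms by (auto simp: residue_ball_def two_adic_units_mult)
qed

text \<open>There are \<open>2 ^ n\<close> odd residues modulo \<open>2 ^ Suc n\<close>. Their balls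
  partition the unit group and have equal measure by invariance.\<close>

lemma measure_haar_residue_ball:
  assumes haar: "normalized_haar two_adic_units \<mu>" and "x \<in> two_adic_units"
  shows "measure \<mu> (residue_ball (Suc n) (residue x (Suc n))) = 1 / 2 ^ n"
proof -
  interpret prob_space \<mu> using haar by (simp add: normalized_haar_def)
  have sets: "sets \<mu> = sets units_borel" using haar by (simp add: normalized_haar_def)
  have space: "space \<mu> = two_adic_units"
    using sets_eq_imp_space_eq[OF sets] by (simp add: space_units_borel)
  let ?m = "measure \<mu> (residue_ball (Suc n) (residue 1 (Suc n)))"
  have eq: "measure \<mu> (residue_ball (Suc n) (residue y (Suc n))) = ?m" if "y \<in> two_adic_units" for y
    using haar that unfolding mult_residue_ball[OF that, symmetric] measure_def normalized_haar_def
    by (simp add: sets)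
  \<comment> \<open>Each odd residue comes from an integer that is itself a unit, so
    \<open>eq\<close> applies to its ball.\<close>
  let ?R = "(\<lambda>k. 2 * k + 1) ` {0..<2 ^ n :: int}"
  have R: "measure \<mu> (residue_ball (Suc n) a) = ?m" if "a \<in> ?R" for a
    using eq[of "of_int a"] that by (auto simp: of_int_two_adic_unit_iff residue_of_int)
  have cover: "two_adic_units = (\<Union>a\<in>?R. residue_ball (Suc n) a)"
  proof -
    have "residue y (Suc n) \<in> ?R" if "y \<in> two_adic_units" for y
    proof -
      have "residue y (Suc n) mod 2 = 1"
        using that residue_mod_le[of 1 "Suc n" y] by (simp add: two_adic_units_iff)
      then have "residue y (Suc n) = 2 * (residue y (Suc n) div 2) + 1"
        by presburger
      moreover have "residue y (Suc n) div 2 \<in> {0..<2 ^ n}"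
        using residue_in_range[of y "Suc n"] by auto
      ultimately show ?thesis by blast
    qed
    then show ?thesis by (auto simp: residue_ball_def)
  qed
  have "1 = measure \<mu> (\<Union>a\<in>?R. residue_ball (Suc n) a)"
    using prob_space unfolding space cover[symmetric] by simp
  also have "\<dots> = (\<Sum>a\<in>?R. measure \<mu> (residue_ball (Suc n) a))"
    by (rule finite_measure_finite_Union)
       (auto simp: sets sets_residue_ball disjoint_family_on_residue_ball)
  also have "\<dots> = 2 ^ n * ?m"
    using R by (simp add: card_image inj_on_def)
  finally show ?thesis
    using eq[OF assms(2)] by (simp add: field_simps)
qed

text \<open>Given the residue of the unit \<open>g (Z \<omega>)\<close>, the target ball for the
  product is a translated ball for \<open>X\<close>, of the same measure. Independence is phrased as
  a product formula because \<open>X\<close> and \<open>Z\<close> take values in different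
  types.\<close>

lemma (in prob_space) prob_mult_haar:
  assumes X: "X \<in> measurable M units_borel" and Z: "Z \<in> measurable M T"
    and indep: "\<And>A B. A \<in> sets units_borel \<Longrightarrow> B \<in> sets T \<Longrightarrow>
      prob ((X -` A \<inter> space M) \<inter> (Z -` B \<inter> space M)) =
        prob (X -` A \<inter> space M) * prob (Z -` B \<inter> space M)"
    and haar: "normalized_haar two_adic_units (distr M units_borel X)"
    and g: "g \<in> measurable T units_borel" and A: "A \<in> sets T" and u: "u \<in> two_adic_units"
  shows "prob {\<omega> \<in> space M. Z \<omega> \<in> A \<and> X \<omega> * g (Z \<omega>) \<in> residue_ball (Suc n) (residue u (Suc n))} =
    prob {\<omega> \<in> space M. Z \<omega> \<in> A} / 2 ^ n"
proof -
  let ?N = "Suc n"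
  note X [measurable] Z [measurable] g [measurable] A [measurable]
  have X_unit: "X \<omega> \<in> two_adic_units" if "\<omega> \<in> space M" for \<omega>
    using measurable_space[OF X that] by (simp add: space_units_borel)
  have g_unit: "g z \<in> two_adic_units" if "z \<in> space T" for z
    using measurable_space[OF g that] by (simp add: space_units_borel)
  note mult [measurable] = measurable_units_mult[OF X measurable_compose[OF Z g]]
  have Z_space: "Z \<omega> \<in> space T" if "\<omega> \<in> space M" for \<omega>
    using measurable_space[OF Z that] .
  \<comment> \<open>Only the residue \<open>b\<close> of \<open>g (Z \<omega>)\<close> matters, and
    it takes finitely many values, so a finite sum replaces an integral over the distribution of
    \<open>Z\<close>.\<close>
  define F where "F b = {\<omega> \<in> space M. Z \<omega> \<in> A \<and> g (Z \<omega>) \<in> residue_ball ?N b}" for b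
  define E where "E b = {\<omega> \<in> F b. X \<omega> * g (Z \<omega>) \<in> residue_ball ?N (residue u ?N)}" for b
  have F_sets: "F b \<in> events" for b unfolding F_def by measurable
  have E_sets: "E b \<in> events" for b unfolding E_def F_def by measurable
  have step: "prob (E b) = prob (F b) / 2 ^ n" for b
  proof (cases ?N b rule: residue_ball_cases)
    case 1
    then show ?thesis by (simp add: E_def F_def)
  next
    case (2 y)
    obtain y' where y': "y' \<in> two_adic_units" "y * y' = 1"
      using two_adic_units_inverse[OF 2(1)] .
    let ?D = "residue_ball ?N (residue (y' * u) ?N)"
    \<comment> \<open>On \<open>F b\<close> the second factor may be replaced by \<open>y\<close>;
      multiplying by its inverse turns the condition on the product into one on \<open>X\<close>
      alone.\<close>
    have *: "residue (x * z) ?N = residue u ?N \<longleftrightarrow> residue x ?N = residue (y' * u) ?N"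
      if "residue z ?N = residue y ?N" for x z
    proof
      assume "residue (x * z) ?N = residue u ?N"
      then have "residue (x * y) ?N = residue u ?N"
        using that by (simp add: residue_times)
      then have "residue (y' * (x * y)) ?N = residue (y' * u) ?N"
        by (simp add: residue_times)
      moreover have "y' * (x * y) = x" using y'(2) by (metis mult.assoc mult.commute mult_1)
      ultimately show "residue x ?N = residue (y' * u) ?N" by simp
    next
      assume "residue x ?N = residue (y' * u) ?N"
      then have "residue (x * z) ?N = residue (y' * u * y) ?N"
        using that by (simp add: residue_times)
      moreover have "y' * u * y = u" using y'(2) by (metis mult.assoc mult.commute mult_1)
      ultimately show "residue (x * z) ?N = residue u ?N" by simp
    qed
    have "E b = {\<omega> \<in> F b. X \<omega> \<in> ?D}"
      using * X_unit by (auto simp: E_def F_def residue_ball_def 2 two_adic_units_mult)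
    also have "\<dots> = (X -` ?D \<inter> space M) \<inter>
        (Z -` (A \<inter> (g -` residue_ball ?N b \<inter> space T)) \<inter> space M)"
      using Z_space by (auto simp: F_def)
    also have "prob \<dots> = prob (X -` ?D \<inter> space M) *
        prob (Z -` (A \<inter> (g -` residue_ball ?N b \<inter> space T)) \<inter> space M)"
      by (rule indep) measurable
    also have "prob (X -` ?D \<inter> space M) = 1 / 2 ^ n"
      using measure_haar_residue_ball[OF haar two_adic_units_mult[OF y'(1) u], of n]
      by (simp add: measure_distr)
    also have "Z -` (A \<inter> (g -` residue_ball ?N b \<inter> space T)) \<inter> space M = F b"
      using Z_space by (auto simp: F_def)
    finally show ?thesis by simp
  qed
  have "{\<omega> \<in> space M. Z \<omega> \<in> A \<and> X \<omega> * g (Z \<omega>) \<in> residue_ball ?N (residue u ?N)} =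
      (\<Union>b\<in>{0..<2 ^ ?N}. E b)"
    using residue_in_range[of _ ?N] g_unit Z_space by (auto simp: E_def F_def residue_ball_def)
  also have "prob \<dots> = (\<Sum>b\<in>{0..<2 ^ ?N}. prob (E b))"
    using E_sets by (intro finite_measure_finite_Union)
      (auto simp: disjoint_family_on_def E_def F_def residue_ball_def)
  also have "\<dots> = (\<Sum>b\<in>{0..<2 ^ ?N}. prob (F b)) / 2 ^ n"
    by (simp only: step sum_divide_distrib)
  also have "(\<Sum>b\<in>{0..<2 ^ ?N}. prob (F b)) = prob (\<Union>b\<in>{0..<2 ^ ?N}. F b)"
    using F_sets by (intro finite_measure_finite_Union[symmetric])
      (auto simp: disjoint_family_on_def F_def residue_ball_def)
  also have "(\<Union>b\<in>{0..<2 ^ ?N}. F b) = {\<omega> \<in> space M. Z \<omega> \<in> A}"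
    using residue_in_range[of _ ?N] g_unit Z_space by (auto simp: F_def residue_ball_def)
  finally show ?thesis .
qed

section \<open>Probabilities of prescribed valuations\<close>

lemma principal_units_mult_cancel:
  assumes "x \<in> two_adic_units" "y \<in> principal_units n" "x * y \<in> principal_units n"
  shows "x \<in> principal_units n"
proof -
  have "2 ^ n dvd (x * y - 1) - x * (y - 1)"
    using assms by (intro dvd_diff[OF _ dvd_mult]) (auto simp: principal_units_def)
  also have "(x * y - 1) - x * (y - 1) = x - 1" by (simp add: algebra_simps)
  finally show ?thesis
    using assms(1) by (simp add: principal_units_def)
qed

text \<open>Valuation exactly \<open>Suc k\<close> means that \<open>x - 1\<close> is an odd
  multiple of \<open>2 ^ Suc k\<close>, which is a single class modulo
  \<open>2 ^ Suc (Suc k)\<close>. In this form equidistribution applies to exact valuations.\<close>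

lemma principal_units_diff_eq_residue_ball:
  "principal_units (Suc k) - principal_units (Suc (Suc k)) =
     residue_ball (Suc (Suc k)) (residue (of_int (1 + 2 ^ Suc k)) (Suc (Suc k)))"
proof -
  let ?N = "Suc (Suc k)"
  have dvd_iff: "2 ^ Suc k dvd b \<and> \<not> 2 ^ ?N dvd b \<longleftrightarrow> 2 ^ ?N dvd b - 2 ^ Suc k" for b :: int
  proof (cases "2 ^ Suc k dvd b")
    case True
    then obtain c where c: "b = 2 ^ Suc k * c" ..
    have "b - 2 ^ Suc k = 2 ^ Suc k * (c - 1)" by (simp add: c algebra_simps)
    then have "2 ^ ?N dvd b - 2 ^ Suc k \<longleftrightarrow> odd c" by (simp only: two_power_Suc_dvd_mult_iff) simp
    moreover have "2 ^ ?N dvd b \<longleftrightarrow> even c" unfolding c by (rule two_power_Suc_dvd_mult_iff)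
    ultimately show ?thesis using True by blast
  next
    case False
    have "2 ^ Suc k dvd b" if "2 ^ ?N dvd b - 2 ^ Suc k"
    proof -
      have "2 ^ Suc k dvd b - 2 ^ Suc k"
        using that by (metis dvd_mult_right power_Suc)
      then have "2 ^ Suc k dvd (b - 2 ^ Suc k) + 2 ^ Suc k"
        by (rule dvd_add) simp
      then show ?thesis by simp
    qed
    with False show ?thesis by blast
  qed
  have "x \<in> principal_units (Suc k) - principal_units ?N \<longleftrightarrow>
      residue x ?N = residue (of_int (1 + 2 ^ Suc k)) ?N" if "x \<in> two_adic_units" for x
  proof -
    have "x \<in> principal_units (Suc k) - principal_units ?N \<longleftrightarrow>
        2 ^ ?N dvd (residue x ?N - 1) - 2 ^ Suc k"
      using that principal_units_iff_residue[of x "Suc k" ?N] principal_units_iff_residue[of x ?N ?N]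
      unfolding dvd_iff[symmetric] by simp
    also have "\<dots> \<longleftrightarrow> residue x ?N mod 2 ^ ?N = (1 + 2 ^ Suc k) mod 2 ^ ?N"
      unfolding mod_eq_dvd_iff by (simp only: diff_diff_eq)
    finally show ?thesis
      unfolding residue_mod residue_of_int .
  qed
  then show ?thesis by (auto simp: residue_ball_def principal_units_def)
qed

lemma (in prob_space) prob_haar_principal_units:
  assumes X: "X \<in> measurable M units_borel"
    and haar: "normalized_haar two_adic_units (distr M units_borel X)"
  shows "prob (X -` principal_units (Suc n) \<inter> space M) = 1 / 2 ^ n"
  using measure_haar_residue_ball[OF haar one_two_adic_units, of n] X
  by (simp add: measure_distr sets_residue_ball principal_units_eq_residue_ball)

lemma (in prob_space) prob_haar_principal_units_diff:
  assumes X: "X \<in> measurable M units_borel"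
    and haar: "normalized_haar two_adic_units (distr M units_borel X)" and "m \<le> n"
  shows "prob (X -` (principal_units (Suc m) - principal_units (Suc n)) \<inter> space M) = 1 / 2 ^ m - 1 / 2 ^ n"
proof -
  have "X -` (principal_units (Suc m) - principal_units (Suc n)) \<inter> space M =
      (X -` principal_units (Suc m) \<inter> space M) - (X -` principal_units (Suc n) \<inter> space M)"
    by auto
  also have "prob \<dots> = prob (X -` principal_units (Suc m) \<inter> space M) -
      prob (X -` principal_units (Suc n) \<inter> space M)"
    using principal_units_antimono[of "Suc m" "Suc n"] \<open>m \<le> n\<close>
    by (intro finite_measure_Diff measurable_sets[OF X] sets_principal_units) auto
  finally show ?thesis
    by (simp only: prob_haar_principal_units[OF X haar])
qed

text \<open>This is \<open>prob_mult_haar\<close> with \<open>p i\<close> as the Haar factor, the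
  family of the other factors as \<open>Z\<close> and their product as \<open>g\<close>. Conditions
  on the other factors thus decouple from the class of the full product.\<close>

lemma (in prob_space) prob_prod_haar:
  assumes indep: "indep_vars (\<lambda>_. units_borel) p I" and I: "finite I" "i \<in> I"
    and haar: "normalized_haar two_adic_units (distr M units_borel (p i))"
    and C: "\<And>j. j \<in> I - {i} \<Longrightarrow> C j \<in> sets units_borel" and u: "u \<in> two_adic_units"
  shows "prob {\<omega> \<in> space M. (\<forall>j\<in>I - {i}. p j \<omega> \<in> C j) \<and>
      (\<Prod>j\<in>I. p j \<omega>) \<in> residue_ball (Suc n) (residue u (Suc n))} =
    prob {\<omega> \<in> space M. \<forall>j\<in>I - {i}. p j \<omega> \<in> C j} / 2 ^ n"
proof -
  let ?J = "I - {i}"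
  let ?T = "PiM ?J (\<lambda>_. units_borel)" and ?Z = "\<lambda>\<omega>. restrict (\<lambda>j. p j \<omega>) ?J"
  have p: "p j \<in> measurable M units_borel" if "j \<in> I" for j
    using indep that by (simp add: indep_vars_def)
  have Z: "?Z \<in> measurable M ?T"
    using p by (intro measurable_restrict) simp
  have *: "prob ((p i -` A \<inter> space M) \<inter> (?Z -` B \<inter> space M)) =
      prob (p i -` A \<inter> space M) * prob (?Z -` B \<inter> space M)"
    if A: "A \<in> sets units_borel" and B: "B \<in> sets ?T" for A B
  proof -
    \<comment> \<open>The single factor is viewed as a family over \<open>{i}\<close>, so that both
      blocks have values in one type, as \<open>indep_var\<close> requires.\<close>
    let ?X = "\<lambda>\<omega>. restrict (\<lambda>j. p j \<omega>) {i}"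
    have "indep_var (PiM {i} (\<lambda>_. units_borel)) ?X ?T ?Z"
      using I by (intro indep_var_restrict[OF indep]) auto
    then have "prob ((\<lambda>\<omega>. (?X \<omega>, ?Z \<omega>)) -` (PiE {i} (\<lambda>_. A) \<times> B) \<inter> space M) =
        prob (?X -` PiE {i} (\<lambda>_. A) \<inter> space M) * prob (?Z -` B \<inter> space M)"
      using A B by (intro indep_varD sets_PiM_I_finite) auto
    moreover have "?X \<omega> \<in> PiE {i} (\<lambda>_. A) \<longleftrightarrow> p i \<omega> \<in> A" for \<omega>
      by (simp add: PiE_iff)
    ultimately show ?thesis
      by (simp add: vimage_def Int_def conj_ac)
  qed
  have g: "(\<lambda>z. \<Prod>j\<in>?J. z j) \<in> measurable ?T units_borel"
    by (rule measurable_units_prod) (rule measurable_component_singleton)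
  have A: "PiE ?J C \<in> sets ?T"
    using I C by (intro sets_PiM_I_finite) auto
  have "?Z \<omega> \<in> PiE ?J C \<longleftrightarrow> (\<forall>j\<in>?J. p j \<omega> \<in> C j)" for \<omega>
    by (auto simp: PiE_iff)
  moreover have "(\<Prod>j\<in>I. p j \<omega>) = p i \<omega> * (\<Prod>j\<in>?J. ?Z \<omega> j)" for \<omega>
    using I by (simp add: prod.remove[of I i])
  ultimately show ?thesis
    using prob_mult_haar[OF p[OF I(2)] Z * haar g A u, of n] by (simp only:)
qed

text \<open>The event is contained, for every \<open>n\<close>, in the one that the product lies in
  \<open>principal_units (Suc n)\<close>, which has probability \<open>1 / 2 ^ n\<close> by
  equidistribution.\<close>

lemma (in prob_space) null_sets_haar_prod_eq_one:
  assumes "indep_vars (\<lambda>_. units_borel) p I" "finite I" "i \<in> I"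
    and "normalized_haar two_adic_units (distr M units_borel (p i))"
  shows "{\<omega> \<in> space M. (\<Prod>j\<in>I. p j \<omega>) = 1} \<in> null_sets M"
proof -
  let ?P = "\<lambda>\<omega>. \<Prod>j\<in>I. p j \<omega>"
  have p: "p j \<in> measurable M units_borel" if "j \<in> I" for j
    using assms(1) that by (simp add: indep_vars_def)
  have p_unit: "p j \<omega> \<in> two_adic_units" if "j \<in> I" "\<omega> \<in> space M" for j \<omega>
    using measurable_space[OF p that(2)] that by (simp add: space_units_borel)
  have P: "?P \<in> measurable M units_borel"
    by (rule measurable_units_prod[OF p])
  have eq: "{\<omega> \<in> space M. ?P \<omega> = 1} = (\<Inter>n. ?P -` principal_units n \<inter> space M)"
    using Inter_principal_units by blast
  have sets: "{\<omega> \<in> space M. ?P \<omega> = 1} \<in> events"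
    unfolding eq
    by (rule sets.countable_INT) (use measurable_sets[OF P sets_principal_units] in blast, simp)
  have "prob {\<omega> \<in> space M. ?P \<omega> = 1} \<le> 1 / 2 ^ n" for n
  proof -
    have "{\<omega> \<in> space M. (\<forall>j\<in>I - {i}. p j \<omega> \<in> two_adic_units) \<and>
        ?P \<omega> \<in> residue_ball (Suc n) (residue 1 (Suc n))} = ?P -` principal_units (Suc n) \<inter> space M"
      using p_unit by (auto simp: principal_units_eq_residue_ball)
    moreover have "{\<omega> \<in> space M. \<forall>j\<in>I - {i}. p j \<omega> \<in> two_adic_units} = space M"
      using p_unit by auto
    ultimately have "prob (?P -` principal_units (Suc n) \<inter> space M) = 1 / 2 ^ n"
      using prob_prod_haar[OF assms, of "\<lambda>_. two_adic_units" 1 n]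
        sets.top[of units_borel] one_two_adic_units
      by (simp add: space_units_borel prob_space)
    moreover have "prob {\<omega> \<in> space M. ?P \<omega> = 1} \<le> prob (?P -` principal_units (Suc n) \<inter> space M)"
      unfolding eq by (intro finite_measure_mono measurable_sets[OF P] sets_principal_units) blast
    ultimately show ?thesis by simp
  qed
  moreover have "(\<lambda>n. 1 / 2 ^ n :: real) \<longlonglongrightarrow> 0"
    using LIMSEQ_realpow_zero[of "1 / 2 :: real"] by (simp add: power_one_over)
  ultimately have "prob {\<omega> \<in> space M. ?P \<omega> = 1} \<le> 0"
    by (intro LIMSEQ_le_const) auto
  then show ?thesis
    using sets by (simp add: null_sets_def emeasure_eq_measure measure_le_0_iff)
qed

lemma (in prob_space) indep_vars_prob_Ball:
  assumes indep: "indep_vars N p I" and I: "finite I" "J \<subseteq> I"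
    and C: "\<And>i. i \<in> J \<Longrightarrow> C i \<in> sets (N i)"
  shows "prob {\<omega> \<in> space M. \<forall>i\<in>J. p i \<omega> \<in> C i} = (\<Prod>i\<in>J. prob (p i -` C i \<inter> space M))"
proof (cases "J = {}")
  case False
  then have "{\<omega> \<in> space M. \<forall>i\<in>J. p i \<omega> \<in> C i} = (\<Inter>i\<in>J. p i -` C i \<inter> space M)"
    by auto
  then show ?thesis
    using indep_varsD[OF indep False finite_subset[OF I(2,1)] I(2) C] by simp
qed (simp add: prob_space)

text \<open>Set aside one index \<open>i \<in> S\<close>. The valuation of the product costs
  \<open>1 / 2 ^ (Suc k + Suc w)\<close>, independently of the other factors; each further index in
  \<open>S\<close> contributes \<open>1 / 2 ^ Suc k\<close>, and each one outside
  \<open>1 / 2 ^ Suc k * (1 - 1 / 2 ^ Suc w)\<close>.\<close>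

lemma (in prob_space) prob_least_and_prod_valuation:
  assumes indep: "indep_vars (\<lambda>_. units_borel) p I" and I: "finite I"
    and haar: "\<And>i. i \<in> I \<Longrightarrow> normalized_haar two_adic_units (distr M units_borel (p i))"
    and S: "S \<subseteq> I" "S \<noteq> {}" "even (card S)"
  shows "prob {\<omega> \<in> space M.
      (\<Prod>i\<in>I. p i \<omega>) \<in> principal_units (Suc k + Suc w) - principal_units (Suc (Suc k + Suc w)) \<and>
      (\<forall>i\<in>S. p i \<omega> \<in> principal_units (Suc k) - principal_units (Suc (Suc k))) \<and>
      (\<forall>i\<in>I - S. p i \<omega> \<in> principal_units (Suc (Suc k)) - principal_units (Suc (Suc k + Suc w)))} =
    (1 / 2 ^ Suc k) ^ card I * (1 / 2 ^ Suc w * (1 - 1 / 2 ^ Suc w) ^ card (I - S))"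
    (is "prob ?B = _")
proof -
  let ?U = principal_units
  obtain i where i: "i \<in> S" using S by blast
  then have iI: "i \<in> I" using S by blast
  let ?J = "I - {i}"
  define C where "C j = (if j \<in> S then ?U (Suc k) - ?U (Suc (Suc k))
    else ?U (Suc (Suc k)) - ?U (Suc (Suc k + Suc w)))" for j
  have C_sets: "C j \<in> sets units_borel" for j
    by (simp add: C_def sets.Diff sets_principal_units)
  have p: "p j \<in> measurable M units_borel" if "j \<in> I" for j
    using indep that by (simp add: indep_vars_def)
  have p_unit: "p j \<omega> \<in> two_adic_units" if "j \<in> I" "\<omega> \<in> space M" for j \<omega>
    using measurable_space[OF p that(2)] that by (simp add: space_units_borel)
  \<comment> \<open>\<open>u - 1\<close> has valuation exactly \<open>Suc k + Suc w\<close>, so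
    \<open>u\<close> represents the class in which the product has to fall.\<close>
  define u where "u = (of_int (1 + 2 ^ (Suc k + Suc w)) :: two_adic)"
  have u: "u \<in> two_adic_units"
    unfolding u_def of_int_two_adic_unit_iff by simp
  \<comment> \<open>The condition on \<open>p i\<close> itself is redundant: it follows from those on \<open>P\<close> and the other factors.\<close>
  have p_i: "p i \<omega> \<in> ?U (Suc k) - ?U (Suc (Suc k))"
    if \<omega>: "\<omega> \<in> space M" "\<forall>j\<in>?J. p j \<omega> \<in> C j" "(\<Prod>j\<in>I. p j \<omega>) \<in> ?U (Suc k + Suc w)" for \<omega>
  proof -
    let ?Y = "\<Prod>j\<in>?J. p j \<omega>"
    have C: "p j \<omega> \<in> ?U (Suc k) \<and> (p j \<omega> \<in> ?U (Suc (Suc k)) \<longleftrightarrow> j \<notin> S)" if "j \<in> ?J" for j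
      using \<omega>(2) that principal_units_antimono[of "Suc k" "Suc (Suc k)"]
      by (auto simp: C_def split: if_splits)
    have "{j \<in> ?J. p j \<omega> \<notin> ?U (Suc (Suc k))} = S - {i}"
      using C S by auto
    \<comment> \<open>Without \<open>i\<close> an odd number of factors misses level
      \<open>Suc (Suc k)\<close>, so \<open>?Y\<close> misses it too. As the full product reaches
      it, \<open>p i \<omega>\<close> cannot.\<close>
    moreover have "odd (card (S - {i}))"
      using i S finite_subset[OF S(1) I] by (simp add: card_gt_0_iff)
    ultimately have Y: "?Y \<notin> ?U (Suc (Suc k))"
      using principal_units_Suc_prod_iff[of ?J "\<lambda>j. p j \<omega>" k] I C by auto
    have Y1: "?Y \<in> ?U (Suc k)"
      using C by (intro principal_units_prod) blast
    have "(\<Prod>j\<in>I. p j \<omega>) = p i \<omega> * ?Y"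
      using I iI by (rule prod.remove)
    then have XY: "p i \<omega> * ?Y \<in> ?U (Suc (Suc k))" "p i \<omega> * ?Y \<in> ?U (Suc k)"
      using \<omega>(3) principal_units_antimono[of "Suc (Suc k)" "Suc k + Suc w"]
        principal_units_antimono[of "Suc k" "Suc k + Suc w"] by auto
    then have X: "p i \<omega> \<in> ?U (Suc k)"
      using principal_units_mult_cancel[OF p_unit[OF iI \<omega>(1)] Y1] by blast
    then show ?thesis
      using principal_units_Suc_mult_iff[OF X Y1] XY Y by blast
  qed
  let ?P = "\<lambda>\<omega>. \<Prod>j\<in>I. p j \<omega>"
    and ?V = "?U (Suc k + Suc w) - ?U (Suc (Suc k + Suc w))"
  have "(?P \<omega> \<in> ?V \<and> (\<forall>j\<in>S. p j \<omega> \<in> ?U (Suc k) - ?U (Suc (Suc k))) \<and>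
      (\<forall>j\<in>I - S. p j \<omega> \<in> ?U (Suc (Suc k)) - ?U (Suc (Suc k + Suc w)))) \<longleftrightarrow>
      ((\<forall>j\<in>?J. p j \<omega> \<in> C j) \<and> ?P \<omega> \<in> ?V)"
    if \<omega>: "\<omega> \<in> space M" for \<omega>
  proof -
    have "p i \<omega> \<in> C i" if "\<forall>j\<in>?J. p j \<omega> \<in> C j" "?P \<omega> \<in> ?V"
      using p_i[OF \<omega> that(1)] that(2) i by (simp add: C_def)
    then have "((\<forall>j\<in>?J. p j \<omega> \<in> C j) \<and> ?P \<omega> \<in> ?V) \<longleftrightarrow> ?P \<omega> \<in> ?V \<and> (\<forall>j\<in>I. p j \<omega> \<in> C j)"
      by blast
    also have "(\<forall>j\<in>I. p j \<omega> \<in> C j) \<longleftrightarrow> (\<forall>j\<in>S. p j \<omega> \<in> C j) \<and> (\<forall>j\<in>I - S. p j \<omega> \<in> C j)"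
      using S(1) by blast
    finally show ?thesis by (simp add: C_def)
  qed
  then have "?B = {\<omega> \<in> space M. (\<forall>j\<in>?J. p j \<omega> \<in> C j) \<and> ?P \<omega> \<in> ?V}"
    by (intro Collect_cong conj_cong[OF refl])
  also have "prob \<dots> = prob {\<omega> \<in> space M. \<forall>j\<in>?J. p j \<omega> \<in> C j} / 2 ^ (Suc k + Suc w)"
  proof -
    have "?V = residue_ball (Suc (Suc k + Suc w)) (residue u (Suc (Suc k + Suc w)))"
      unfolding u_def add_Suc by (rule principal_units_diff_eq_residue_ball)
    then show ?thesis
      using prob_prod_haar[OF indep I iI haar[OF iI] C_sets u] by (simp only:)
  qed
  also have "prob {\<omega> \<in> space M. \<forall>j\<in>?J. p j \<omega> \<in> C j} = (\<Prod>j\<in>?J. prob (p j -` C j \<inter> space M))"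
    by (rule indep_vars_prob_Ball[OF indep I]) (auto simp: C_sets)
  also have "\<dots> = (\<Prod>j\<in>?J. if j \<in> S then 1 / 2 ^ Suc k else 1 / 2 ^ Suc k - 1 / 2 ^ (Suc k + Suc w))"
  proof (rule prod.cong)
    fix j assume "j \<in> ?J"
    then have j: "p j \<in> measurable M units_borel" "normalized_haar two_adic_units (distr M units_borel (p j))"
      using p haar by auto
    have "(1 / 2 ^ k - 1 / 2 ^ Suc k :: real) = 1 / 2 ^ Suc k" by (simp add: field_simps)
    then show "prob (p j -` C j \<inter> space M) =
        (if j \<in> S then 1 / 2 ^ Suc k else 1 / 2 ^ Suc k - 1 / 2 ^ (Suc k + Suc w))"
      using prob_haar_principal_units_diff[OF j, of k "Suc k"]
        prob_haar_principal_units_diff[OF j, of "Suc k" "Suc k + Suc w"]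
      unfolding C_def by simp
  qed simp
  also have "\<dots> = (1 / 2 ^ Suc k) ^ card (S - {i}) * (1 / 2 ^ Suc k - 1 / 2 ^ (Suc k + Suc w)) ^ card (I - S)"
  proof -
    have "?J \<inter> S = S - {i}" "?J \<inter> - S = I - S" using i S by auto
    then show ?thesis
      using I by (simp add: prod.If_cases)
  qed
  also have "(1 / 2 ^ Suc k - 1 / 2 ^ (Suc k + Suc w)) = (1 / 2 ^ Suc k) * (1 - 1 / 2 ^ Suc w :: real)"
    by (simp add: power_add field_simps)
  \<comment> \<open>The part \<open>1 / 2 ^ Suc k\<close> of the cost of the product stands in for
    the omitted factor \<open>i\<close> and completes the exponent to \<open>card I\<close>.\<close>
  also have "(1 / 2 ^ Suc k) ^ card (S - {i}) * ((1 / 2 ^ Suc k) * (1 - 1 / 2 ^ Suc w :: real)) ^ card (I - S) /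
        2 ^ (Suc k + Suc w) = (1 / 2 ^ Suc k) ^ (Suc (card (S - {i})) + card (I - S)) * (1 / 2 ^ Suc w * (1 - 1 / 2 ^ Suc w) ^ card (I - S))"
    unfolding power_mult_distrib power_add power_Suc[of _ "card (S - {i})"]
    by (simp only: times_divide_eq_left times_divide_eq_right divide_divide_eq_left mult_1 mult_ac)
  also have "Suc (card (S - {i})) + card (I - S) = card I"
    using i S I finite_subset[OF S(1) I]
    by (metis card_Suc_Diff1 card_Diff_subset card_mono le_add_diff_inverse)
  finally show ?thesis .
qed

section \<open>Geometric series and sums over subsets\<close>

lemma sums_geometric_powers:
  assumes "m \<noteq> 0"
  shows "(\<lambda>k. (1 / 2 ^ Suc k) ^ m) sums (1 / (2 ^ m - 1) :: real)"
proof -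
  let ?a = "1 / 2 ^ m :: real"
  have lt: "(1 :: real) < 2 ^ m" using assms by (simp add: one_less_power)
  then have "(\<lambda>k. ?a * ?a ^ k) sums (?a * (1 / (1 - ?a)))"
    by (intro sums_mult geometric_sums) simp
  \<comment> \<open>As \<open>k\<close> enters through \<open>Suc k\<close>, the series starts at
    the first power of \<open>?a\<close>.\<close>
  moreover have "?a * ?a ^ k = (1 / 2 ^ Suc k) ^ m" for k
    by (simp add: power_one_over flip: power_mult power_add)
  moreover have "?a * (1 / (1 - ?a)) = 1 / (2 ^ m - 1)"
    using lt by (simp add: field_simps)
  ultimately show ?thesis by (simp only:)
qed

text \<open>With \<open>t = 1 / 2 ^ Suc w\<close>, expand \<open>(1 - t) ^ n\<close> and sum each
  \<open>t ^ (j + 1)\<close> over \<open>w\<close> as a geometric series.\<close>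

lemma sums_geometric_binomial:
  "(\<lambda>w. 1 / 2 ^ Suc w * (1 - 1 / 2 ^ Suc w) ^ n) sums
     (\<Sum>j=0..n. (-1) ^ j * real (n choose j) * (1 / (2 ^ (j + 1) - 1)))"
proof -
  have "(\<lambda>w. \<Sum>j=0..n. (-1) ^ j * real (n choose j) * (1 / 2 ^ Suc w) ^ (j + 1)) sums
     (\<Sum>j=0..n. (-1) ^ j * real (n choose j) * (1 / (2 ^ (j + 1) - 1)))"
    by (intro sums_sum sums_mult sums_geometric_powers) simp
  moreover have "(\<Sum>j=0..n. (-1) ^ j * real (n choose j) * t ^ (j + 1)) = t * (1 - t) ^ n" for t :: real
  proof -
    have "(1 - t) ^ n = (\<Sum>j=0..n. real (n choose j) * (- t) ^ j)"
      using binomial_ring[of "- t" 1 n] by (simp add: atMost_atLeast0)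
    then show ?thesis
      by (simp add: sum_distrib_left power_minus[of t] mult_ac)
  qed
  ultimately show ?thesis by (simp only:)
qed

lemma sum_over_subsets_by_card:
  assumes "finite I"
  shows "(\<Sum>S | S \<subseteq> I \<and> P (card S). f (card S)) =
    (\<Sum>s | s \<le> card I \<and> P s. of_nat (card I choose s) * (f s :: 'a :: comm_semiring_1))"
proof -
  let ?E = "{S. S \<subseteq> I \<and> P (card S)}" and ?T = "{s. s \<le> card I \<and> P s}"
  have "(\<Sum>S\<in>?E. f (card S)) = (\<Sum>s\<in>?T. \<Sum>S | S \<in> ?E \<and> card S = s. f (card S))"
    using assms by (intro sum.group[symmetric]) (auto simp: card_mono)
  also have "\<dots> = (\<Sum>s\<in>?T. of_nat (card I choose s) * f s)"
  proof (rule sum.cong)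
    fix s assume "s \<in> ?T"
    then have "{S. S \<in> ?E \<and> card S = s} = {S. S \<subseteq> I \<and> card S = s}" by auto
    then show "(\<Sum>S | S \<in> ?E \<and> card S = s. f (card S)) = of_nat (card I choose s) * f s"
      using n_subsets[OF assms, of s] by simp
  qed simp
  finally show ?thesis .
qed

section \<open>Uniqueness of the valuation data\<close>

lemma principal_units_diff_unique:
  assumes "x \<in> principal_units m - principal_units (Suc m)"
    and "x \<in> principal_units n - principal_units (Suc n)"
  shows "m = n"
proof (rule ccontr)
  assume "m \<noteq> n"
  then have "Suc m \<le> n \<or> Suc n \<le> m" by linarith
  then show False
    using assms principal_units_antimono[of "Suc m" n] principal_units_antimono[of "Suc n" m] by blast
qed

text \<open>\<open>k\<close> is the minimum of the valuations of the \<open>x i - 1\<close> and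
  \<open>S\<close> the set where it is attained, so \<open>x\<close> determines both. This separates
  the events of the final decomposition.\<close>

lemma least_valuation_unique:
  assumes S: "S \<subseteq> I" "S \<noteq> {}" "\<forall>i\<in>S. x i \<in> principal_units k - principal_units (Suc k)"
      "\<forall>i\<in>I - S. x i \<in> principal_units (Suc k)"
    and S': "S' \<subseteq> I" "S' \<noteq> {}" "\<forall>i\<in>S'. x i \<in> principal_units k' - principal_units (Suc k')"
      "\<forall>i\<in>I - S'. x i \<in> principal_units (Suc k')"
  shows "S = S'" "k = k'"
proof -
  \<comment> \<open>An index in \<open>T\<close> has valuation exactly \<open>m\<close>, while every
    valuation is at least \<open>n\<close>. Both directions together give
    \<open>k = k'\<close>.\<close>
  have le: "n \<le> m" if "T \<subseteq> I" "T \<noteq> {}" "\<forall>i\<in>T. x i \<in> principal_units m - principal_units (Suc m)"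
      "\<forall>i\<in>T'. x i \<in> principal_units n - principal_units (Suc n)"
      "\<forall>i\<in>I - T'. x i \<in> principal_units (Suc n)" for T T' m n
  proof (rule ccontr)
    assume "\<not> n \<le> m"
    obtain i where "i \<in> T" using \<open>T \<noteq> {}\<close> by blast
    then have "i \<in> I" using \<open>T \<subseteq> I\<close> by blast
    then have "x i \<in> principal_units n"
      using that(4,5) principal_units_antimono[of n "Suc n"] by (cases "i \<in> T'") auto
    then show False
      using \<open>i \<in> T\<close> \<open>\<not> n \<le> m\<close> that(3) principal_units_antimono[of "Suc m" n] by auto
  qed
  show k: "k = k'"
    using le[OF S(1-3) S'(3,4)] le[OF S'(1-3) S(3,4)] by simp
  have "S = {i \<in> I. x i \<notin> principal_units (Suc k)}" using S by blast
  also have "\<dots> = S'" unfolding k using S' by blast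
  finally show "S = S'" .
qed

section \<open>Assembling the probability\<close>

theorem theoremA2:
  fixes r :: nat and M :: "'w measure" and p :: "nat \<Rightarrow> 'w \<Rightarrow> two_adic"
  assumes "r \<ge> 3"
    and "prob_space M"
    and "prob_space.indep_vars M (\<lambda>_. restrict_space borel two_adic_units) p {1..r}"
    and "\<And>i. i \<in> {1..r} \<Longrightarrow>
           normalized_haar two_adic_units (distr M (restrict_space borel two_adic_units) (p i))"
  shows "measure M {\<omega> \<in> space M. two_korselt r (\<lambda>i. p i \<omega>)} =
    1 / (2 ^ r - 1) *
      (1 + (\<Sum>s | 2 \<le> s \<and> s < r \<and> even s.
              real (r choose s) *
              (\<Sum>j=0..r - s. (-1) ^ j * real ((r - s) choose j) * (1 / (2 ^ (j + 1) - 1)))))"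
proof -
  interpret prob_space M by fact
  let ?I = "{1..r}" and ?U = principal_units
  let ?P = "\<lambda>\<omega>. \<Prod>i\<in>?I. p i \<omega>"
  note indep = assms(3) and haar = assms(4)
  have p: "p i \<in> measurable M units_borel" if "i \<in> ?I" for i
    using indep that by (simp add: indep_vars_def)
  have p_unit: "p i \<omega> \<in> two_adic_units" if "i \<in> ?I" "\<omega> \<in> space M" for i \<omega>
    using measurable_space[OF p that(2)] that by (simp add: space_units_borel)
  have P: "?P \<in> measurable M units_borel"
    by (rule measurable_units_prod[OF p])

  define h where "h n = (\<Sum>j=0..n. (-1) ^ j * real (n choose j) * (1 / (2 ^ (j + 1) - 1)))" for n
  define E where "E = {S. S \<subset> ?I \<and> S \<noteq> {} \<and> even (card S)}"
  \<comment> \<open>Here \<open>?P - 1\<close> has infinite valuation. The event may meet some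
    \<open>A k\<close>, which is harmless since it is null.\<close>
  define N where "N = {\<omega> \<in> space M. ?P \<omega> = 1}"
  define A where "A k = {\<omega> \<in> space M. \<forall>i\<in>?I. p i \<omega> \<in> ?U (Suc k) - ?U (Suc (Suc k))}" for k
  define B where "B S k w = {\<omega> \<in> space M.
      ?P \<omega> \<in> ?U (Suc k + Suc w) - ?U (Suc (Suc k + Suc w)) \<and>
      (\<forall>i\<in>S. p i \<omega> \<in> ?U (Suc k) - ?U (Suc (Suc k))) \<and>
      (\<forall>i\<in>?I - S. p i \<omega> \<in> ?U (Suc (Suc k)) - ?U (Suc (Suc k + Suc w)))}" for S k w
  \<comment> \<open>All cases with least valuation \<open>Suc k\<close> are gathered, since their
    probabilities share the factor \<open>(1 / 2 ^ Suc k) ^ r\<close>.\<close>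
  define G where "G k = A k \<union> (\<Union>S\<in>E. \<Union>w. B S k w)" for k

  \<comment> \<open>Measurability of the events\<close>
  have E_I: "S \<subseteq> ?I" "S \<noteq> {}" "even (card S)" "S \<noteq> ?I" "finite S" if "S \<in> E" for S
    using that finite_subset[of S ?I] by (auto simp: E_def)
  have fin_E: "finite E"
    by (rule finite_subset[of _ "Pow ?I"]) (auto simp: E_def)
  have p_sets: "p i -` (?U m - ?U n) \<inter> space M \<in> events" if "i \<in> ?I" for i m n
    by (rule measurable_sets[OF p[OF that]]) (intro sets.Diff sets_principal_units)
  have P_sets: "?P -` (?U m - ?U n) \<inter> space M \<in> events" for m n
    by (rule measurable_sets[OF P]) (intro sets.Diff sets_principal_units)
  have Ball_sets: "{\<omega> \<in> space M. \<forall>i\<in>J. p i \<omega> \<in> ?U m - ?U n} \<in> events" if "J \<subseteq> ?I" for J m n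
  proof (rule sets.sets_Collect_finite_All)
    show "finite J" using that by (rule finite_subset) simp
    fix i assume "i \<in> J"
    then have "p i -` (?U m - ?U n) \<inter> space M \<in> events" using p_sets that by blast
    then show "{\<omega> \<in> space M. p i \<omega> \<in> ?U m - ?U n} \<in> events"
      by (simp only: vimage_def Int_def mem_Collect_eq conj_commute)
  qed
  have A_sets: "A k \<in> events" for k
    unfolding A_def by (rule Ball_sets) simp
  have B_sets: "B S k w \<in> events" if "S \<subseteq> ?I" for S k w
  proof -
    have "B S k w = (?P -` (?U (Suc k + Suc w) - ?U (Suc (Suc k + Suc w))) \<inter> space M) \<inter>
        {\<omega> \<in> space M. \<forall>i\<in>S. p i \<omega> \<in> ?U (Suc k) - ?U (Suc (Suc k))} \<inter>
        {\<omega> \<in> space M. \<forall>i\<in>?I - S. p i \<omega> \<in> ?U (Suc (Suc k)) - ?U (Suc (Suc k + Suc w))}"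
      unfolding B_def by blast
    also have "\<dots> \<in> events"
      by (intro sets.Int P_sets Ball_sets that Diff_subset)
    finally show ?thesis .
  qed
  have BU_sets: "(\<Union>w. B S k w) \<in> events" if "S \<in> E" for S k
    using B_sets[OF E_I(1)[OF that]] by (intro sets.countable_UN) blast
  have G_sets: "G k \<in> events" for k
    unfolding G_def by (intro sets.Un sets.finite_UN A_sets BU_sets fin_E)

  \<comment> \<open>Disjointness of the events\<close>
  have A_least: "\<forall>i\<in>?I. p i \<omega> \<in> ?U (Suc k) - ?U (Suc (Suc k))" if "\<omega> \<in> A k" for \<omega> k
    using that by (simp add: A_def)
  have B_least: "\<forall>i\<in>S. p i \<omega> \<in> ?U (Suc k) - ?U (Suc (Suc k))" "\<forall>i\<in>?I - S. p i \<omega> \<in> ?U (Suc (Suc k))"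
    if "\<omega> \<in> B S k w" for \<omega> S k w
    using that by (simp_all add: B_def)
  have G_least: "\<exists>S. S \<subseteq> ?I \<and> S \<noteq> {} \<and> (\<forall>i\<in>S. p i \<omega> \<in> ?U (Suc k) - ?U (Suc (Suc k))) \<and>
      (\<forall>i\<in>?I - S. p i \<omega> \<in> ?U (Suc (Suc k)))" if "\<omega> \<in> G k" for \<omega> k
    using that unfolding G_def
  proof (elim UnE UN_E)
    assume "\<omega> \<in> A k"
    then show ?thesis
      using A_least \<open>r \<ge> 3\<close> by (intro exI[of _ ?I]) auto
  next
    fix S w assume "S \<in> E" "\<omega> \<in> B S k w"
    then show ?thesis
      using E_I B_least by (intro exI[of _ S] conjI)
  qed
  have G_disj: "disjoint_family G"
  proof (unfold disjoint_family_on_def, intro ballI impI equals0I)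
    fix k k' \<omega> assume "k \<noteq> k'" "\<omega> \<in> G k \<inter> G k'"
    then show False
      using G_least[of \<omega> k] G_least[of \<omega> k'] least_valuation_unique(2)[of _ ?I "\<lambda>i. p i \<omega>"]
      by (metis IntD1 IntD2 nat.inject)
  qed
  have B_disj: "disjoint_family (B S k)" for S k
  proof (unfold disjoint_family_on_def, intro ballI impI equals0I)
    fix w w' \<omega> assume "w \<noteq> w'" "\<omega> \<in> B S k w \<inter> B S k w'"
    then show False
      using principal_units_diff_unique[of "?P \<omega>" "Suc k + Suc w" "Suc k + Suc w'"] by (simp add: B_def)
  qed
  have BU_disj: "disjoint_family_on (\<lambda>S. \<Union>w. B S k w) E" for k
  proof (unfold disjoint_family_on_def, intro ballI impI equals0I)
    fix S S' \<omega> assume S: "S \<in> E" "S' \<in> E" "S \<noteq> S'" and "\<omega> \<in> (\<Union>w. B S k w) \<inter> (\<Union>w. B S' k w)"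
    then obtain w w' where "\<omega> \<in> B S k w" "\<omega> \<in> B S' k w'" by blast
    then show False
      using least_valuation_unique(1)[OF E_I(1,2)[OF S(1)] B_least E_I(1,2)[OF S(2)] B_least] S(3)
      by blast
  qed
  have A_BU_disj: "A k \<inter> (\<Union>S\<in>E. \<Union>w. B S k w) = {}" for k
  proof (rule equals0I)
    fix \<omega> assume "\<omega> \<in> A k \<inter> (\<Union>S\<in>E. \<Union>w. B S k w)"
    then obtain S w where S: "S \<in> E" and "\<omega> \<in> A k" "\<omega> \<in> B S k w" by blast
    \<comment> \<open>\<open>S\<close> is proper, so on \<open>B S k w\<close> some factor reaches
      level \<open>Suc (Suc k)\<close>, which \<open>A k\<close> forbids.\<close>
    moreover obtain i where "i \<in> ?I - S" using E_I[OF S] by blast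
    ultimately show False
      using A_least B_least(2) by blast
  qed

  \<comment> \<open>Summation over \<open>w\<close>, \<open>S\<close> and \<open>k\<close>\<close>
  have prob_A: "prob (A k) = (1 / 2 ^ Suc k) ^ r" for k
  proof -
    have "prob (A k) = (\<Prod>i\<in>?I. prob (p i -` (?U (Suc k) - ?U (Suc (Suc k))) \<inter> space M))"
      unfolding A_def
      by (rule indep_vars_prob_Ball[OF indep]) (auto intro: sets.Diff sets_principal_units)
    also have "\<dots> = (\<Prod>i\<in>?I. 1 / 2 ^ Suc k)"
    proof (rule prod.cong)
      fix i assume i: "i \<in> ?I"
      have "(1 / 2 ^ k - 1 / 2 ^ Suc k :: real) = 1 / 2 ^ Suc k" by (simp add: field_simps)
      then show "prob (p i -` (?U (Suc k) - ?U (Suc (Suc k))) \<inter> space M) = 1 / 2 ^ Suc k"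
        using prob_haar_principal_units_diff[OF p[OF i] haar[OF i], of k "Suc k"] by simp
    qed simp
    finally show ?thesis by simp
  qed
  have prob_BU: "prob (\<Union>w. B S k w) = (1 / 2 ^ Suc k) ^ r * h (r - card S)" if "S \<in> E" for S k
  proof -
    have "card (?I - S) = r - card S"
      using E_I[OF that] by (simp add: card_Diff_subset)
    then have "prob (B S k w) =
        (1 / 2 ^ Suc k) ^ r * (1 / 2 ^ Suc w * (1 - 1 / 2 ^ Suc w) ^ (r - card S))" for w
      unfolding B_def
      using prob_least_and_prod_valuation[OF indep finite_atLeastAtMost haar E_I(1-3)[OF that], of k w]
      by (simp only: card_atLeastAtMost diff_Suc_1)
    moreover have "(\<lambda>w. prob (B S k w)) sums prob (\<Union>w. B S k w)"
      using B_sets[OF E_I(1)[OF that]] B_disj by (intro finite_measure_UNION) blast+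
    moreover have "(\<lambda>w. (1 / 2 ^ Suc k) ^ r * (1 / 2 ^ Suc w * (1 - 1 / 2 ^ Suc w) ^ (r - card S)))
        sums ((1 / 2 ^ Suc k) ^ r * h (r - card S))"
      unfolding h_def by (intro sums_mult sums_geometric_binomial)
    ultimately show ?thesis
      by (simp only: sums_unique2)
  qed
  have "prob (G k) = (1 / 2 ^ Suc k) ^ r * (1 + (\<Sum>S\<in>E. h (r - card S)))" for k
  proof -
    have "prob (G k) = prob (A k) + prob (\<Union>S\<in>E. \<Union>w. B S k w)"
      unfolding G_def
      by (intro finite_measure_Union sets.finite_UN A_sets BU_sets fin_E A_BU_disj)
    also have "prob (\<Union>S\<in>E. \<Union>w. B S k w) = (\<Sum>S\<in>E. prob (\<Union>w. B S k w))"
      using fin_E BU_sets BU_disj by (intro finite_measure_finite_Union) auto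
    also have "\<dots> = (1 / 2 ^ Suc k) ^ r * (\<Sum>S\<in>E. h (r - card S))"
      by (simp only: prob_BU sum_distrib_left cong: sum.cong)
    finally show ?thesis
      by (simp only: prob_A distrib_left mult_1_right)
  qed
  moreover have "(\<lambda>k. prob (G k)) sums prob (\<Union>k. G k)"
    by (rule finite_measure_UNION[OF image_subsetI[OF G_sets] G_disj])
  ultimately have "(\<lambda>k. (1 / 2 ^ Suc k) ^ r * (1 + (\<Sum>S\<in>E. h (r - card S)))) sums prob (\<Union>k. G k)"
    by (simp only:)
  moreover have "(\<lambda>k. (1 / 2 ^ Suc k) ^ r * (1 + (\<Sum>S\<in>E. h (r - card S)))) sums
      (1 / (2 ^ r - 1) * (1 + (\<Sum>S\<in>E. h (r - card S))))"
    using \<open>r \<ge> 3\<close> by (intro sums_mult2 sums_geometric_powers) simp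
  ultimately have prob_G: "prob (\<Union>k. G k) = 1 / (2 ^ r - 1) * (1 + (\<Sum>S\<in>E. h (r - card S)))"
    by (rule sums_unique2)

  \<comment> \<open>The Korselt event up to a null set, and grouping by cardinality\<close>
  have "{\<omega> \<in> space M. two_korselt r (\<lambda>i. p i \<omega>)} = (\<Union>k. G k) \<union> N"
  proof -
    have "two_korselt r (\<lambda>i. p i \<omega>) \<longleftrightarrow> \<omega> \<in> (\<Union>k. G k) \<union> N" if "\<omega> \<in> space M" for \<omega>
    proof -
      have "two_korselt r (\<lambda>i. p i \<omega>) \<longleftrightarrow>
          \<omega> \<in> N \<or> (\<exists>k. \<omega> \<in> A k) \<or> (\<exists>S\<in>E. \<exists>k w. \<omega> \<in> B S k w)"
        using two_korselt_cases[of r "\<lambda>i. p i \<omega>"] p_unit that \<open>r \<ge> 3\<close>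
        by (simp add: N_def A_def B_def E_def)
      then show ?thesis unfolding G_def by blast
    qed
    moreover have "(\<Union>k. G k) \<union> N \<subseteq> space M"
      using sets.sets_into_space[OF G_sets] by (auto simp: N_def)
    ultimately show ?thesis by blast
  qed
  moreover have "N \<in> null_sets M"
    unfolding N_def using \<open>r \<ge> 3\<close> by (intro null_sets_haar_prod_eq_one[OF indep _ _ haar, of 1]) auto
  moreover have "(\<Union>k. G k) \<in> events"
    using G_sets by blast
  ultimately have "prob {\<omega> \<in> space M. two_korselt r (\<lambda>i. p i \<omega>)} = prob (\<Union>k. G k)"
    by (simp only: measure_Un_null_set)
  also have "\<dots> = 1 / (2 ^ r - 1) * (1 + (\<Sum>S\<in>E. h (r - card S)))"
    by (rule prob_G)
  also have "(\<Sum>S\<in>E. h (r - card S)) =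
      (\<Sum>s | 2 \<le> s \<and> s < r \<and> even s. real (r choose s) * h (r - s))"
  proof -
    \<comment> \<open>For even cardinality, nonempty means at least two elements; proper means fewer
      than \<open>r\<close>. This yields the range of \<open>s\<close> in the formula.\<close>
    have "S \<in> E \<longleftrightarrow> S \<subseteq> ?I \<and> 2 \<le> card S \<and> card S < r \<and> even (card S)" for S
    proof (cases "S \<subseteq> ?I")
      case True
      then have fin: "finite S" using finite_subset by blast
      have "S \<subset> ?I \<longleftrightarrow> card S < r"
        using True psubset_card_mono[of ?I S] by auto
      moreover have "S \<noteq> {} \<longleftrightarrow> 2 \<le> card S" if "even (card S)"
      proof -
        have "2 \<le> n \<longleftrightarrow> n \<noteq> 0" if "even n" for n :: nat using that by presburger
        then show ?thesis using that fin by (simp add: card_gt_0_iff)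
      qed
      ultimately show ?thesis
        using True unfolding E_def by blast
    qed (auto simp: E_def)
    then have "(\<Sum>S\<in>E. h (r - card S)) =
        (\<Sum>S | S \<subseteq> ?I \<and> 2 \<le> card S \<and> card S < r \<and> even (card S). h (r - card S))"
      by (intro sum.cong) blast+
    also have "\<dots> = (\<Sum>s | s \<le> r \<and> 2 \<le> s \<and> s < r \<and> even s. real (r choose s) * h (r - s))"
      using sum_over_subsets_by_card[of ?I "\<lambda>s. h (r - s)" "\<lambda>s. 2 \<le> s \<and> s < r \<and> even s"]
      by simp
    also have "{s. s \<le> r \<and> 2 \<le> s \<and> s < r \<and> even s} = {s. 2 \<le> s \<and> s < r \<and> even s}"
      by auto
    finally show ?thesis .
  qed
  finally show ?thesis
    unfolding h_def .
qed

end
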